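(* Let $H\in M_n(\mathbb{Z})$ be a skew-symmetric matrix of rank $r$ in canonical form with non-degenerate part $\Lambda(\underline{m})$, that is, $H=\begin{pmatrix}\Lambda(\underline{m})&0\\0&0\end{pmatrix}$, where $\underline{m}=(m_1,\dots,m_N)$, $2N=r$. Assume that $q$ is a primitive $\ell$-th root of $1$ for some integer $\ell\ge2$ which is $\Lambda(\underline{m})$-coprime, i.e. $\gcd(m_i,\ell)=1$ for all $i$. Then the automorphism group of $\mathcal{L}_q[H]$ (with generators $y_1^{\pm1},\dots,y_n^{\pm1}$) is $$\mathrm{Aut}(\mathcal{L}_q[H])=\left\{\tau_{\underline{c}}\,\tau_M \mid \underline{c}\in(\mathbb{C}^* )^n,\ M\in Q_\ell(\underline{m},\mathbb{Z})\right\},$$ where for $\underline{c}=(c_1,\dots,c_n)^T\in(\mathbb{C}^* )^n$ and $M=(\alpha_1,\dots,\alpha_n)\in Q_\ell(\underline{m},\mathbb{Z})$ (with columns $\alpha_i\in\mathbb{Z}^n$) the automorphisms $\tau_{\underline{c}}$, $\tau_M$ are given by $\tau_{\underline{c}}(y_i)=c_iy_i$ and $\tau_M(y_i)=y^{\alpha_i}$ for $i=1,\dots,n$.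
   Context: For a skew-symmetric $H=(h_{ij})\in M_n(\mathbb{Z})$ and $q\in\mathbb{C}^*$, $\mathcal{L}_q[H]$ is the associative unital $\mathbb{C}$-algebra generated by $y_1,\dots,y_n$ and their inverses with relations $y_iy_j=q^{h_{ij}}y_jy_i$ for all $i,j$. For $\alpha=(a_1,\dots,a_n)^T\in\mathbb{Z}^n$, $y^{\alpha}=y_1^{a_1}\cdots y_n^{a_n}$. Automorphisms are $\mathbb{C}$-algebra automorphisms. Let $S=\begin{pmatrix}0&1\\-1&0\end{pmatrix}$; for positive integers $m_1\le\cdots\le m_N$ put $\Lambda(\underline{m})=\mathrm{diag}(m_1S,\dots,m_NS)$ (block diagonal, $r\times r$ with $r=2N$). $\mathrm{GL}_n(\mathbb{Z})$ is the group of integer $n\times n$ matrices with determinant $\pm1$. $Q_\ell(\underline{m},\mathbb{Z})$ is the set of matrices $M=\begin{pmatrix}A&B\\C&D\end{pmatrix}\in\mathrm{GL}_n(\mathbb{Z})$ with $A\in M_r(\mathbb{Z})$, $B,C^T\in M_{r\times(n-r)}(\mathbb{Z})$, $D\in M_{n-r}(\mathbb{Z})$ such that $A^T\Lambda(\underline{m})A\equiv\Lambda(\underline{m})\pmod{\ell}$ and $B\equiv0\pmod{\ell}$ (entrywise congruences). *)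

theory Defs
  imports
    "HOL-Algebra.QuotRing"
    "HOL-Library.Poly_Mapping"
    "HOL-Number_Theory.Cong"
    "Jordan_Normal_Form.Determinant"
begin

section \<open>Free associative algebras over the complex numbers\<close>

text \<open>
  Words over an alphabet, as a monoid written additively with concatenation as \<open>+\<close>.
  The additive notation makes \<open>'a fword \<Rightarrow>\<^sub>0 complex\<close>, with the convolution product
  provided by the library, the free algebra on \<open>'a\<close>.
\<close>

datatype 'a fword = Word (letters: "'a list")

instantiation fword :: (type) monoid_add
begin

definition zero_fword :: "'a fword" where
  "0 = Word []"

definition plus_fword :: "'a fword \<Rightarrow> 'a fword \<Rightarrow> 'a fword" where
  "u + v = Word (letters u @ letters v)"

instance
  by standard (simp_all add: zero_fword_def plus_fword_def)

end

definition free_algebra :: "'a set \<Rightarrow> ('a fword \<Rightarrow>\<^sub>0 complex) ring" where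
  "free_algebra X =
    \<lparr>carrier = {f. \<forall>w\<in>Poly_Mapping.keys f. set (letters w) \<subseteq> X},
     monoid.mult = (*), monoid.one = 1, ring.zero = 0, ring.add = (+)\<rparr>"

definition scalar :: "complex \<Rightarrow> ('a fword \<Rightarrow>\<^sub>0 complex)" where
  "scalar c = Poly_Mapping.single 0 c"

definition free_gen :: "'a \<Rightarrow> ('a fword \<Rightarrow>\<^sub>0 complex)" where
  "free_gen x = Poly_Mapping.single (Word [x]) 1"

lemma ring_free_algebra: "ring (free_algebra X)"
proof (rule ringI)
  show "abelian_group (free_algebra X)"
  proof (rule abelian_groupI)
    fix f assume f: "f \<in> carrier (free_algebra X)"
    show "\<exists>g\<in>carrier (free_algebra X). g \<oplus>\<^bsub>free_algebra X\<^esub> f = \<zero>\<^bsub>free_algebra X\<^esub>"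
      using f by (intro bexI[of _ "- f"]) (auto simp: free_algebra_def)
  qed (use Poly_Mapping.keys_add in \<open>fastforce simp: free_algebra_def algebra_simps\<close>)+
  show "monoid (free_algebra X)"
  proof (rule monoidI)
    fix f g assume fg: "f \<in> carrier (free_algebra X)" "g \<in> carrier (free_algebra X)"
    show "f \<otimes>\<^bsub>free_algebra X\<^esub> g \<in> carrier (free_algebra X)"
      using fg keys_mult[of f g] by (fastforce simp: free_algebra_def plus_fword_def)
  qed (auto simp: free_algebra_def zero_fword_def mult.assoc)
qed (auto simp: free_algebra_def algebra_simps)


section \<open>Quantum Laurent polynomial algebras\<close>

text \<open>Indices run from \<open>0\<close> to \<open>n - 1\<close> instead of from \<open>1\<close> to \<open>n\<close>.\<close>

datatype gen = Gen nat | Gen_inv nat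

definition gens :: "nat \<Rightarrow> gen set" where
  "gens n = Gen ` {..<n} \<union> Gen_inv ` {..<n}"

definition laurent_rels :: "complex \<Rightarrow> int mat \<Rightarrow> (gen fword \<Rightarrow>\<^sub>0 complex) set" where
  "laurent_rels q H =
     {free_gen (Gen i) * free_gen (Gen_inv i) - 1 | i. i < dim_row H} \<union>
     {free_gen (Gen_inv i) * free_gen (Gen i) - 1 | i. i < dim_row H} \<union>
     {free_gen (Gen i) * free_gen (Gen j) - scalar (q powi (H $$ (i, j))) * free_gen (Gen j) * free_gen (Gen i) | i j.
        i < dim_row H \<and> j < dim_row H}"

definition laurent_ideal :: "complex \<Rightarrow> int mat \<Rightarrow> (gen fword \<Rightarrow>\<^sub>0 complex) set" where
  "laurent_ideal q H = genideal (free_algebra (gens (dim_row H))) (laurent_rels q H)"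

definition laurent_quot :: "complex \<Rightarrow> int mat \<Rightarrow> (gen fword \<Rightarrow>\<^sub>0 complex) set ring" where
  "laurent_quot q H = free_algebra (gens (dim_row H)) Quot laurent_ideal q H"

definition laurent_class ::
    "complex \<Rightarrow> int mat \<Rightarrow> (gen fword \<Rightarrow>\<^sub>0 complex) \<Rightarrow> (gen fword \<Rightarrow>\<^sub>0 complex) set" where
  "laurent_class q H f = laurent_ideal q H +>\<^bsub>free_algebra (gens (dim_row H))\<^esub> f"

text \<open>
  The algebra \<open>\<L>\<^sub>q[H]\<close> as a ring with scalar multiplication, the scalar \<open>c\<close> acting as
  multiplication by the class of \<open>c \<cdot> 1\<close>.  The record \<open>module\<close> serves only as a container.
\<close>

definition laurent :: "complex \<Rightarrow> int mat \<Rightarrow> (complex, (gen fword \<Rightarrow>\<^sub>0 complex) set) module" where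
  "laurent q H =
    \<lparr>carrier = carrier (laurent_quot q H),
     monoid.mult = monoid.mult (laurent_quot q H),
     monoid.one = monoid.one (laurent_quot q H),
     ring.zero = ring.zero (laurent_quot q H),
     ring.add = ring.add (laurent_quot q H),
     module.smult = (\<lambda>c x. laurent_class q H (scalar c) \<otimes>\<^bsub>laurent_quot q H\<^esub> x)\<rparr>"

definition y_gen :: "complex \<Rightarrow> int mat \<Rightarrow> nat \<Rightarrow> (gen fword \<Rightarrow>\<^sub>0 complex) set" where
  "y_gen q H i = laurent_class q H (free_gen (Gen i))"

definition y_monomial :: "complex \<Rightarrow> int mat \<Rightarrow> int vec \<Rightarrow> (gen fword \<Rightarrow>\<^sub>0 complex) set" where
  "y_monomial q H \<alpha> =
     foldr (\<lambda>i z. (y_gen q H i [^]\<^bsub>laurent q H\<^esub> (\<alpha> $ i)) \<otimes>\<^bsub>laurent q H\<^esub> z)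
       [0..<dim_row H] \<one>\<^bsub>laurent q H\<^esub>"


section \<open>Automorphisms\<close>

text \<open>
  Automorphisms of unital \<open>\<complex>\<close>-algebras.  Extensionality makes them determined by
  their values on the carrier; the group operation is \<open>compose (carrier L)\<close>.
\<close>

definition alg_aut :: "(complex, 'b) module \<Rightarrow> ('b \<Rightarrow> 'b) set" where
  "alg_aut L = {\<phi> \<in> ring_iso L L \<inter> extensional (carrier L).
     \<forall>c. \<forall>x\<in>carrier L. \<phi> (c \<odot>\<^bsub>L\<^esub> x) = c \<odot>\<^bsub>L\<^esub> \<phi> x}"

definition is_tau_scal :: "complex \<Rightarrow> int mat \<Rightarrow> complex vec \<Rightarrow>
    ((gen fword \<Rightarrow>\<^sub>0 complex) set \<Rightarrow> (gen fword \<Rightarrow>\<^sub>0 complex) set) \<Rightarrow> bool" where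
  "is_tau_scal q H c \<tau> \<longleftrightarrow> \<tau> \<in> alg_aut (laurent q H) \<and>
     (\<forall>i<dim_row H. \<tau> (y_gen q H i) = (c $ i) \<odot>\<^bsub>laurent q H\<^esub> y_gen q H i)"

definition is_tau_mat :: "complex \<Rightarrow> int mat \<Rightarrow> int mat \<Rightarrow>
    ((gen fword \<Rightarrow>\<^sub>0 complex) set \<Rightarrow> (gen fword \<Rightarrow>\<^sub>0 complex) set) \<Rightarrow> bool" where
  "is_tau_mat q H M \<tau> \<longleftrightarrow> \<tau> \<in> alg_aut (laurent q H) \<and>
     (\<forall>i<dim_row H. \<tau> (y_gen q H i) = y_monomial q H (col M i))"

definition tau_scal where
  "tau_scal q H c = (THE \<tau>. is_tau_scal q H c \<tau>)"

definition tau_mat where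
  "tau_mat q H M = (THE \<tau>. is_tau_mat q H M \<tau>)"


section \<open>Matrix data\<close>

definition S_mat :: "int mat" where
  "S_mat = mat_of_rows_list 2 [[0, 1], [-1, 0]]"

definition Lambda :: "nat list \<Rightarrow> int mat" where
  "Lambda ms = diag_block_mat (map (\<lambda>m. int m \<cdot>\<^sub>m S_mat) ms)"

definition canonical_form :: "nat \<Rightarrow> nat list \<Rightarrow> int mat" where
  "canonical_form n ms = (let r = 2 * length ms in
     four_block_mat (Lambda ms) (0\<^sub>m r (n - r)) (0\<^sub>m (n - r) r) (0\<^sub>m (n - r) (n - r)))"

definition mat_cong :: "nat \<Rightarrow> int mat \<Rightarrow> int mat \<Rightarrow> bool" where
  "mat_cong l A B \<longleftrightarrow> dim_row A = dim_row B \<and> dim_col A = dim_col B \<and>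
     (\<forall>i<dim_row A. \<forall>j<dim_col A. [A $$ (i, j) = B $$ (i, j)] (mod int l))"

definition GL_int :: "nat \<Rightarrow> int mat set" where
  "GL_int n = {M \<in> carrier_mat n n. det M = 1 \<or> det M = -1}"

definition Q_group :: "nat \<Rightarrow> nat \<Rightarrow> nat list \<Rightarrow> int mat set" where
  "Q_group n l ms = (let r = 2 * length ms in
     {M \<in> GL_int n. \<exists>A B C D. M = four_block_mat A B C D \<and>
        A \<in> carrier_mat r r \<and> B \<in> carrier_mat r (n - r) \<and>
        C \<in> carrier_mat (n - r) r \<and> D \<in> carrier_mat (n - r) (n - r) \<and>
        mat_cong l (transpose_mat A * Lambda ms * A) (Lambda ms) \<and>
        mat_cong l B (0\<^sub>m r (n - r))})"

definition torus :: "nat \<Rightarrow> complex vec set" where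
  "torus n = {c \<in> carrier_vec n. \<forall>i<n. c $ i \<noteq> 0}"

definition primitive_root_of_one :: "nat \<Rightarrow> complex \<Rightarrow> bool" where
  "primitive_root_of_one l q \<longleftrightarrow> q ^ l = 1 \<and> (\<forall>k. 0 < k \<and> k < l \<longrightarrow> q ^ k \<noteq> 1)"

end

theory Submission
  imports Defs
begin

text \<open>
  Sending a word to its degree, weighted with a suitable power of \<open>q\<close>, maps the free algebra onto the
  group algebra of \<open>\<int>\<^sup>n\<close> twisted by a bicharacter.  The kernel is the defining ideal, because every
  word of degree \<open>0\<close> reduces to a scalar.  As \<open>\<int>\<^sup>n\<close> can be ordered, the invertible
  elements of \<open>\<L>\<^sub>q[H]\<close> are the scalar multiples of monomials.  So an automorphism maps the generators
  to such multiples; their degrees are the columns of an invertible integer matrix \<open>M\<close>, and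
  the commutation relations say that \<open>M\<^sup>T H M \<equiv> H\<close> modulo \<open>l\<close>.  Conversely each such \<open>M\<close> defines
  an automorphism, and two automorphisms with the same matrix differ by a scaling of
  the generators.  Finally, coprimality of \<open>\<Lambda>\<close> and \<open>l\<close> turns \<open>M\<^sup>T H M \<equiv> H\<close> into the block conditions
  that define \<open>Q_group\<close>.
\<close>

section \<open>Additive extensions and twisted convolution\<close>

text \<open>A presentation bounds the algebra only from above: the relations alone do not show that
  two elements differ or that an element has no inverse. The map \<open>nf\<close> supplies a
  faithful model in which equality is a comparison of coefficients. Its twist is the one-sided form
  \<open>order_form\<close>, which counts just the exchanges that sort a product; half of the skew
  form would do as well but would require a choice of square root of \<open>q\<close>. Sorted
  monomials multiply only up to powers of \<open>q\<close>, so the substitutions attached to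
  \<open>M\<close> and \<open>N\<close> compose to that of \<open>M * N\<close> only up to a scaling
  of the generators. For this reason the proof works with degrees of \<open>homogeneous\<close>
  elements and forgets coefficients. Commutation of two such elements depends on their degrees alone
  (\<open>homogeneous_swap_iff\<close>), so the relations become a condition on the matrix, and the
  torus restores what was forgotten (\<open>homogeneous_proportional\<close>). For the same reason
  bijectivity is derived from composites that are scalings rather than identities
  (\<open>alg_autI\<close>).\<close>

definition lin_ext :: "('a \<Rightarrow> 'b::zero \<Rightarrow> 'c::comm_monoid_add) \<Rightarrow> ('a \<Rightarrow>\<^sub>0 'b) \<Rightarrow> 'c" where
  "lin_ext h f = (\<Sum>k\<in>Poly_Mapping.keys f. h k (Poly_Mapping.lookup f k))"

lemma lin_ext_zero [simp]: "lin_ext h 0 = 0"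
  by (simp add: lin_ext_def)

lemma lin_ext_single: "h k 0 = 0 \<Longrightarrow> lin_ext h (Poly_Mapping.single k a) = h k a"
  by (simp add: lin_ext_def)

lemma lin_ext_add:
  fixes h :: "'a \<Rightarrow> 'b::comm_monoid_add \<Rightarrow> 'c::comm_monoid_add"
  assumes "\<And>k. h k 0 = 0" "\<And>k a b. h k (a + b) = h k a + h k b"
  shows "lin_ext h (f + g) = lin_ext h f + lin_ext h g"
  unfolding lin_ext_def using assms by (intro setsum_keys_plus_distrib) auto

lemma lin_ext_fun_add: "lin_ext (\<lambda>k a. h k a + h' k a) f = lin_ext h f + lin_ext h' f"
  by (simp add: lin_ext_def sum.distrib)

lemma sum_single_lookup: "(\<Sum>k\<in>Poly_Mapping.keys f. Poly_Mapping.single k (Poly_Mapping.lookup f k)) = f"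
  by (rule poly_mapping_eqI)
     (auto simp: lookup_sum lookup_single when_def in_keys_iff)

text \<open>With the words over \<open>gens n\<close> as \<open>S\<close>, an induction on an
  element of \<open>free\<close> never leaves its carrier.\<close>

lemma poly_mapping_induct_on [consumes 1, case_names single add]:
  fixes f :: "'a \<Rightarrow>\<^sub>0 'b::comm_monoid_add"
  assumes "Poly_Mapping.keys f \<subseteq> S"
    and single: "\<And>k a. k \<in> S \<Longrightarrow> P (Poly_Mapping.single k a)"
    and add: "\<And>f g. Poly_Mapping.keys f \<subseteq> S \<Longrightarrow> Poly_Mapping.keys g \<subseteq> S \<Longrightarrow> P f \<Longrightarrow> P g \<Longrightarrow> P (f + g)"
    and "P 0"
  shows "P f"
proof -
  have "P (\<Sum>k\<in>K. Poly_Mapping.single k (Poly_Mapping.lookup f k)) \<and>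
      Poly_Mapping.keys (\<Sum>k\<in>K. Poly_Mapping.single k (Poly_Mapping.lookup f k)) \<subseteq> S"
    if "finite K" "K \<subseteq> S" for K
    using that
  proof (induction K)
    case empty
    then show ?case using \<open>P 0\<close> by simp
  next
    case (insert k K)
    let ?s = "Poly_Mapping.single k (Poly_Mapping.lookup f k)"
    let ?r = "\<Sum>k\<in>K. Poly_Mapping.single k (Poly_Mapping.lookup f k)"
    from insert have "P ?r" "Poly_Mapping.keys ?r \<subseteq> S" "Poly_Mapping.keys ?s \<subseteq> S" "P ?s"
      by (auto intro: single)
    then show ?case
      using insert.hyps add[of ?s ?r] Poly_Mapping.keys_add[of ?s ?r] by auto
  qed
  from this[OF finite_keys assms(1)] show ?thesis
    by (simp add: sum_single_lookup)
qed

lemmas poly_mapping_add_induct = poly_mapping_induct_on[where S = UNIV, OF subset_UNIV, case_names single add zero]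

text \<open>Both sides are biadditive in \<open>f\<close> and \<open>g\<close>, so monomials
  suffice. The product \<open>P\<close> is a parameter because it is
  \<open>twisted_mult twist\<close> for \<open>nf\<close> but the ordinary product for the
  substitution in \<open>alg_end_exists\<close>.\<close>

lemma lin_ext_mult:
  fixes h :: "'a::monoid_add \<Rightarrow> 'b::semiring_0 \<Rightarrow> 'c::comm_monoid_add"
  assumes h: "\<And>k. h k 0 = 0" "\<And>k a b. h k (a + b) = h k a + h k b"
    and P: "\<And>x. P x 0 = 0" "\<And>x. P 0 x = 0" "\<And>x y z. P x (y + z) = P x y + P x z"
      "\<And>x y z. P (x + y) z = P x z + P y z"
    and hP: "\<And>u v a b. h (u + v) (a * b) = P (h u a) (h v b)"
  shows "lin_ext h (f * g) = P (lin_ext h f) (lin_ext h g)"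
proof (induction f rule: poly_mapping_add_induct)
  case (single u a)
  show ?case
  proof (induction g rule: poly_mapping_add_induct)
    case (single v b)
    then show ?case by (simp add: mult_single lin_ext_single h hP)
  qed (simp_all add: distrib_left lin_ext_add h P)
qed (simp_all add: distrib_right lin_ext_add h P)

definition twisted_mult ::
    "('a::plus \<Rightarrow> 'a \<Rightarrow> 'b::comm_ring_1) \<Rightarrow> ('a \<Rightarrow>\<^sub>0 'b) \<Rightarrow> ('a \<Rightarrow>\<^sub>0 'b) \<Rightarrow> ('a \<Rightarrow>\<^sub>0 'b)" where
  "twisted_mult t f g =
     lin_ext (\<lambda>d a. lin_ext (\<lambda>e b. Poly_Mapping.single (d + e) (a * b * t d e)) g) f"

lemma twisted_mult_zero [simp]: "twisted_mult t 0 g = 0" "twisted_mult t f 0 = 0"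
  by (simp_all add: twisted_mult_def) (simp add: lin_ext_def)

lemma twisted_mult_add:
  "twisted_mult t (f + f') g = twisted_mult t f g + twisted_mult t f' g"
  "twisted_mult t f (g + g') = twisted_mult t f g + twisted_mult t f g'"
  unfolding twisted_mult_def
  subgoal by (subst lin_ext_add) (simp_all add: algebra_simps single_add lin_ext_fun_add, simp add: lin_ext_def)
  subgoal by (subst lin_ext_add) (simp_all add: algebra_simps single_add lin_ext_fun_add)
  done

lemma twisted_mult_single:
  "twisted_mult t (Poly_Mapping.single d a) (Poly_Mapping.single e b) = Poly_Mapping.single (d + e) (a * b * t d e)"
  by (simp add: twisted_mult_def lin_ext_single)

lemma lookup_twisted_mult:
  "Poly_Mapping.lookup (twisted_mult t f g) k =
     (\<Sum>d\<in>Poly_Mapping.keys f. \<Sum>e\<in>Poly_Mapping.keys g.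
        if d + e = k then Poly_Mapping.lookup f d * Poly_Mapping.lookup g e * t d e else 0)"
  by (simp add: twisted_mult_def lin_ext_def lookup_sum lookup_single when_def)

text \<open>A degree that arises from just one pair of keys admits no cancellation. The extreme
  degrees of a product are of this kind.\<close>

lemma lookup_twisted_mult_unique_pair:
  assumes "d \<in> Poly_Mapping.keys f" "e \<in> Poly_Mapping.keys g"
    and "\<And>d' e'. d' \<in> Poly_Mapping.keys f \<Longrightarrow> e' \<in> Poly_Mapping.keys g \<Longrightarrow> d' + e' = d + e \<Longrightarrow> d' = d \<and> e' = e"
  shows "Poly_Mapping.lookup (twisted_mult t f g) (d + e) =
    Poly_Mapping.lookup f d * Poly_Mapping.lookup g e * t d e"
proof -
  have "Poly_Mapping.lookup (twisted_mult t f g) (d + e) =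
     (\<Sum>d'\<in>Poly_Mapping.keys f. \<Sum>e'\<in>Poly_Mapping.keys g.
        if d' = d \<and> e' = e then Poly_Mapping.lookup f d' * Poly_Mapping.lookup g e' * t d' e' else 0)"
    unfolding lookup_twisted_mult using assms by (intro sum.cong refl) auto
  also have "\<dots> = (\<Sum>d'\<in>Poly_Mapping.keys f. if d' = d then Poly_Mapping.lookup f d * Poly_Mapping.lookup g e * t d e else 0)"
    using assms(2) by (intro sum.cong refl) (auto)
  finally show ?thesis using assms(1) by simp
qed

text \<open>In a product the two largest degrees add up, and so do the two smallest; if the product has
  degree \<open>0\<close>, then these sums coincide.\<close>

lemma twisted_mult_eq_oneD:
  fixes f g :: "'a::linordered_ab_group_add \<Rightarrow>\<^sub>0 'b::idom"
  assumes t: "\<And>d e. t d e \<noteq> 0" and fg: "twisted_mult t f g = Poly_Mapping.single 0 1"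
  obtains d a where "a \<noteq> 0" "f = Poly_Mapping.single d a"
proof -
  let ?F = "Poly_Mapping.keys f" and ?G = "Poly_Mapping.keys g"
  have "f \<noteq> 0" "g \<noteq> 0"
    using fg by auto
  then have ne: "?F \<noteq> {}" "?G \<noteq> {}"
    using sum_single_lookup[of f] sum_single_lookup[of g] by auto
  have in_keys: "Max ?F \<in> ?F" "Max ?G \<in> ?G" "Min ?F \<in> ?F" "Min ?G \<in> ?G"
    using ne by auto
  \<comment> \<open>Such a degree has a nonzero coefficient in the product, whose only degree is
    \<open>0\<close>.\<close>
  have *: "d + e = 0" if "d \<in> ?F" "e \<in> ?G"
    and "\<And>d' e'. d' \<in> ?F \<Longrightarrow> e' \<in> ?G \<Longrightarrow> d' + e' = d + e \<Longrightarrow> d' = d \<and> e' = e" for d e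
  proof -
    have "Poly_Mapping.lookup (twisted_mult t f g) (d + e) =
        Poly_Mapping.lookup f d * Poly_Mapping.lookup g e * t d e"
      by (rule lookup_twisted_mult_unique_pair) (fact that)+
    also have "\<dots> \<noteq> 0"
      using that(1,2) t[of d e] by (simp add: in_keys_iff)
    finally show ?thesis unfolding fg by (metis lookup_single_not_eq)
  qed
  have bounds: "d \<le> Max ?F" "Min ?F \<le> d" if "d \<in> ?F" for d
    using that by auto
  have bounds': "d \<le> Max ?G" "Min ?G \<le> d" if "d \<in> ?G" for d
    using that by auto
  have "Max ?F + Max ?G = 0"
  proof (rule *)
    fix d e assume "d \<in> ?F" "e \<in> ?G" "d + e = Max ?F + Max ?G"
    with bounds(1)[of d] bounds'(1)[of e] show "d = Max ?F \<and> e = Max ?G"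
      by (metis add_le_cancel_left add_le_cancel_right add_left_imp_eq order_antisym)
  qed (use in_keys in auto)
  moreover have "Min ?F + Min ?G = 0"
  proof (rule *)
    fix d e assume "d \<in> ?F" "e \<in> ?G" "d + e = Min ?F + Min ?G"
    with bounds(2)[of d] bounds'(2)[of e] show "d = Min ?F \<and> e = Min ?G"
      by (metis add_le_cancel_left add_le_cancel_right add_left_imp_eq order_antisym)
  qed (use in_keys in auto)
  ultimately have "Max ?F \<le> Min ?F"
    using bounds'(1)[OF in_keys(4)] by (metis add_le_cancel_left add_le_cancel_right)
  then have "?F = {Max ?F}"
    using bounds in_keys(1) by (force intro: antisym order_trans)
  then have "f = Poly_Mapping.single (Max ?F) (Poly_Mapping.lookup f (Max ?F))"
    using sum_single_lookup[of f] by (metis finite.emptyI sum.empty sum.insert empty_iff add_0_right)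
  moreover have "Poly_Mapping.lookup f (Max ?F) \<noteq> 0"
    using in_keys(1) by (simp add: in_keys_iff)
  ultimately show thesis using that by blast
qed

section \<open>The normal form of an element of the free algebra\<close>

fun letter_degree :: "gen \<Rightarrow> nat \<Rightarrow>\<^sub>0 int" where
  "letter_degree (Gen i) = Poly_Mapping.single i 1"
| "letter_degree (Gen_inv i) = Poly_Mapping.single i (- 1)"

definition word_degree :: "gen fword \<Rightarrow> nat \<Rightarrow>\<^sub>0 int" where
  "word_degree w = sum_list (map letter_degree (letters w))"

lemma word_degree_simps [simp]:
  "word_degree 0 = 0" "word_degree (u + v) = word_degree u + word_degree v"
  "word_degree (Word []) = 0" "word_degree (Word (x # xs)) = letter_degree x + word_degree (Word xs)"
  by (simp_all add: word_degree_def zero_fword_def plus_fword_def)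

lemma Gen_in_gens [simp]: "Gen i \<in> gens n \<longleftrightarrow> i < n" "Gen_inv i \<in> gens n \<longleftrightarrow> i < n"
  by (auto simp: gens_def)

section \<open>The bicharacter of \<open>H\<close> and the weight of a word\<close>

locale quantum_laurent =
  fixes q :: complex and H :: "int mat" and n :: nat
  assumes q_nonzero: "q \<noteq> 0"
    and H_carrier: "H \<in> carrier_mat n n"
    and H_skew: "\<And>i j. i < n \<Longrightarrow> j < n \<Longrightarrow> H $$ (i, j) = - H $$ (j, i)"
begin

lemma dim_row_H [simp]: "dim_row H = n"
  using H_carrier by auto

definition skew_form :: "(nat \<Rightarrow>\<^sub>0 int) \<Rightarrow> (nat \<Rightarrow>\<^sub>0 int) \<Rightarrow> int" where
  "skew_form d e = (\<Sum>i<n. \<Sum>j<n. H $$ (i, j) * Poly_Mapping.lookup d i * Poly_Mapping.lookup e j)"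

text \<open>Exponent of \<open>q\<close> in \<open>y\<^sup>d y\<^sup>e = q\<^sup>k y\<^sup>d\<^sup>+\<^sup>e\<close>.\<close>

definition order_form :: "(nat \<Rightarrow>\<^sub>0 int) \<Rightarrow> (nat \<Rightarrow>\<^sub>0 int) \<Rightarrow> int" where
  "order_form d e = (\<Sum>i<n. \<Sum>j<n. if j < i then H $$ (i, j) * Poly_Mapping.lookup d i * Poly_Mapping.lookup e j else 0)"

definition twist :: "(nat \<Rightarrow>\<^sub>0 int) \<Rightarrow> (nat \<Rightarrow>\<^sub>0 int) \<Rightarrow> complex" where
  "twist d e = q powi order_form d e"

lemma order_form_add:
  "order_form (c + d) e = order_form c e + order_form d e"
  "order_form c (d + e) = order_form c d + order_form c e"
  unfolding order_form_def
  by (auto simp: lookup_add algebra_simps simp flip: sum.distrib intro!: sum.cong)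

text \<open>Bimultiplicativity lets \<open>word_coeff_add\<close> split a concatenation, which in
  turn makes \<open>nf\<close> multiplicative.\<close>

lemma twist_add:
  "twist (c + d) e = twist c e * twist d e"
  "twist c (d + e) = twist c d * twist c e"
  by (simp_all add: twist_def order_form_add power_int_add q_nonzero)

lemma twist_nonzero [simp]: "twist d e \<noteq> 0"
  by (simp add: twist_def q_nonzero)

lemma twist_zero [simp]: "twist 0 d = 1" "twist d 0 = 1"
proof -
  have "order_form 0 d = 0" "order_form d 0 = 0"
    unfolding order_form_def by (auto intro!: sum.neutral)
  then show "twist 0 d = 1" "twist d 0 = 1" by (simp_all add: twist_def)
qed

lemma twist_single_same [simp]: "twist (Poly_Mapping.single i a) (Poly_Mapping.single i b) = 1"
proof -
  have "order_form (Poly_Mapping.single i a) (Poly_Mapping.single i b) = 0"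
    unfolding order_form_def by (intro sum.neutral ballI) (auto simp: lookup_single when_def)
  then show ?thesis by (simp add: twist_def)
qed

text \<open>The first term contributes the pairs \<open>j < i\<close>, the second the pairs
  \<open>i < j\<close> with a sign that skew-symmetry of \<open>H\<close> absorbs, and the diagonal
  of \<open>H\<close> vanishes.\<close>

lemma skew_form_eq: "skew_form d e = order_form d e - order_form e d"
proof -
  have "order_form e d = (\<Sum>i<n. \<Sum>j<n. if i < j then H $$ (j, i) * Poly_Mapping.lookup e j * Poly_Mapping.lookup d i else 0)"
    unfolding order_form_def by (rule sum.swap)
  then have "order_form d e - order_form e d = (\<Sum>i<n. \<Sum>j<n.
      (if j < i then H $$ (i, j) * Poly_Mapping.lookup d i * Poly_Mapping.lookup e j else 0) -
      (if i < j then H $$ (j, i) * Poly_Mapping.lookup e j * Poly_Mapping.lookup d i else 0))"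
    by (simp add: order_form_def sum_subtractf)
  also have "\<dots> = skew_form d e"
    unfolding skew_form_def
  proof (intro sum.cong refl)
    fix i j assume "i \<in> {..<n}" "j \<in> {..<n}"
    then have "H $$ (i, j) = - H $$ (j, i)" "i = j \<Longrightarrow> H $$ (i, j) = 0"
      using H_skew[of i j] by auto
    then show "(if j < i then H $$ (i, j) * Poly_Mapping.lookup d i * Poly_Mapping.lookup e j else 0) -
      (if i < j then H $$ (j, i) * Poly_Mapping.lookup e j * Poly_Mapping.lookup d i else 0) =
      H $$ (i, j) * Poly_Mapping.lookup d i * Poly_Mapping.lookup e j"
      by (cases i j rule: linorder_cases) auto
  qed
  finally show ?thesis by simp
qed

lemma twist_swap: "twist d e = q powi skew_form d e * twist e d"
  using power_int_add[of q "skew_form d e" "order_form e d"] q_nonzero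
  by (simp add: twist_def skew_form_eq)

lemma skew_form_single:
  assumes "i < n" "j < n"
  shows "skew_form (Poly_Mapping.single i a) (Poly_Mapping.single j b) = H $$ (i, j) * a * b"
proof -
  have "skew_form (Poly_Mapping.single i a) (Poly_Mapping.single j b) =
      (\<Sum>i'<n. \<Sum>j'<n. if j' = j then (if i' = i then H $$ (i, j) * a * b else 0) else 0)"
    unfolding skew_form_def by (intro sum.cong refl) (auto simp: lookup_single when_def)
  then show ?thesis using assms by simp
qed

text \<open>The scalar between a word and the sorted monomial of its degree: a letter put in front
  costs the exchanges that move it into place. Thus \<open>nf\<close> lists coefficients with
  respect to sorted monomials.\<close>

primrec list_coeff :: "gen list \<Rightarrow> complex" where
  "list_coeff [] = 1"
| "list_coeff (x # xs) = list_coeff xs * twist (letter_degree x) (word_degree (Word xs))"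

definition word_coeff :: "gen fword \<Rightarrow> complex" where
  "word_coeff w = list_coeff (letters w)"

lemma word_coeff_simps [simp]: "word_coeff 0 = 1" "word_coeff (Word [x]) = 1"
  by (simp_all add: word_coeff_def zero_fword_def)

lemma word_coeff_nonzero [simp]: "word_coeff w \<noteq> 0"
proof -
  have "list_coeff xs \<noteq> 0" for xs
    by (induction xs) auto
  then show ?thesis by (simp add: word_coeff_def)
qed

lemma word_coeff_add:
  "word_coeff (u + v) = word_coeff u * word_coeff v * twist (word_degree u) (word_degree v)"
proof -
  have "list_coeff (xs @ letters v) =
      list_coeff xs * word_coeff v * twist (word_degree (Word xs)) (word_degree v)" for xs
  proof (induction xs)
    case (Cons x xs)
    have "word_degree (Word (xs @ letters v)) = word_degree (Word xs) + word_degree v"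
      by (simp add: word_degree_def)
    with Cons show ?case by (simp add: twist_add)
  qed (simp add: word_coeff_def)
  from this[of "letters u"] show ?thesis
    by (simp add: word_coeff_def plus_fword_def)
qed

definition nf :: "(gen fword \<Rightarrow>\<^sub>0 complex) \<Rightarrow> ((nat \<Rightarrow>\<^sub>0 int) \<Rightarrow>\<^sub>0 complex)" where
  "nf = lin_ext (\<lambda>w a. Poly_Mapping.single (word_degree w) (a * word_coeff w))"

lemma nf_zero [simp]: "nf 0 = 0"
  by (simp add: nf_def)

lemma nf_single: "nf (Poly_Mapping.single w a) = Poly_Mapping.single (word_degree w) (a * word_coeff w)"
  by (simp add: nf_def lin_ext_single)

lemma nf_one [simp]: "nf 1 = Poly_Mapping.single 0 1"
  using nf_single[of 0 1] by simp

lemma nf_add: "nf (f + g) = nf f + nf g"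
  unfolding nf_def by (rule lin_ext_add) (simp_all add: algebra_simps single_add)

lemma nf_minus [simp]: "nf (- f) = - nf f"
  using nf_add[of f "- f"] by (simp add: eq_neg_iff_add_eq_0 add.commute)

lemma nf_diff: "nf (f - g) = nf f - nf g"
  using nf_add[of f "- g"] by simp

lemma nf_mult: "nf (f * g) = twisted_mult twist (nf f) (nf g)"
  unfolding nf_def
  by (rule lin_ext_mult)
     (simp_all add: twisted_mult_add algebra_simps single_add twisted_mult_single word_coeff_add)

section \<open>The defining ideal is the kernel of the normal form\<close>

abbreviation "free \<equiv> free_algebra (gens n)"
abbreviation "rel_ideal \<equiv> laurent_ideal q H"

lemma free_simps [simp]:
  "f \<otimes>\<^bsub>free_algebra X\<^esub> g = f * g" "f \<oplus>\<^bsub>free_algebra X\<^esub> g = f + g"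
  "\<one>\<^bsub>free_algebra X\<^esub> = 1" "\<zero>\<^bsub>free_algebra X\<^esub> = 0"
  by (simp_all add: free_algebra_def)

sublocale free: ring free
  by (rule ring_free_algebra)

lemma carrier_free: "f \<in> carrier free \<longleftrightarrow> (\<forall>w\<in>Poly_Mapping.keys f. set (letters w) \<subseteq> gens n)"
  by (simp add: free_algebra_def)

lemma carrier_freeI [intro, simp]:
  "f \<in> carrier free \<Longrightarrow> g \<in> carrier free \<Longrightarrow> f + g \<in> carrier free"
  "f \<in> carrier free \<Longrightarrow> g \<in> carrier free \<Longrightarrow> f * g \<in> carrier free"
  "f \<in> carrier free \<Longrightarrow> - f \<in> carrier free"
  "f \<in> carrier free \<Longrightarrow> g \<in> carrier free \<Longrightarrow> f - g \<in> carrier free"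
  "1 \<in> carrier free" "0 \<in> carrier free" "scalar c \<in> carrier free"
  "i < n \<Longrightarrow> free_gen (Gen i) \<in> carrier free" "i < n \<Longrightarrow> free_gen (Gen_inv i) \<in> carrier free"
proof -
  show add: "f \<in> carrier free \<Longrightarrow> g \<in> carrier free \<Longrightarrow> f + g \<in> carrier free" for f g
    using free.a_closed[of f g] by simp
  show uminus: "f \<in> carrier free \<Longrightarrow> - f \<in> carrier free" for f
    by (simp add: carrier_free in_keys_iff)
  show "f \<in> carrier free \<Longrightarrow> g \<in> carrier free \<Longrightarrow> f - g \<in> carrier free" for f g
    using add[of f "- g"] uminus[of g] by simp
  show "f \<in> carrier free \<Longrightarrow> g \<in> carrier free \<Longrightarrow> f * g \<in> carrier free" for f g
    using free.m_closed[of f g] by simp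
  show "1 \<in> carrier free" "0 \<in> carrier free"
    using free.one_closed free.zero_closed by simp_all
qed (simp_all add: carrier_free scalar_def free_gen_def zero_fword_def)

lemma carrier_free_single: "set (letters w) \<subseteq> gens n \<Longrightarrow> Poly_Mapping.single w a \<in> carrier free"
  by (simp add: carrier_free)

lemma free_a_inv [simp]: "f \<in> carrier free \<Longrightarrow> \<ominus>\<^bsub>free\<^esub> f = - f"
  by (intro free.minus_equality) auto

lemma laurent_rels_carrier: "laurent_rels q H \<subseteq> carrier free"
  by (auto simp: laurent_rels_def intro!: carrier_freeI)

sublocale rel_ideal: ideal rel_ideal free
  using free.genideal_ideal[OF laurent_rels_carrier] by (simp add: laurent_ideal_def)

lemma laurent_rels_subset: "laurent_rels q H \<subseteq> rel_ideal"
  using free.genideal_self[OF laurent_rels_carrier] by (simp add: laurent_ideal_def)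

text \<open>The defining ideal is the least one that contains the relations, so it lies in this
  kernel as soon as \<open>nf\<close> kills the relations.\<close>

lemma nf_kernel_ideal: "ideal {f \<in> carrier free. nf f = 0} free"
proof (rule idealI[OF ring_free_algebra])
  show "subgroup {f \<in> carrier free. nf f = 0} (add_monoid free)"
    by (rule free.add.subgroupI) (auto simp: nf_add)
qed (auto simp: nf_mult)

text \<open>The inverse relations hold because \<open>twist\<close> is \<open>1\<close> on multiples
  of a single generator, the commutation relations because of \<open>twist_swap\<close>.\<close>

lemma nf_laurent_rels:
  assumes "f \<in> laurent_rels q H"
  shows "nf f = 0"
proof -
  have n2: "nf (free_gen x * free_gen y) = Poly_Mapping.single (letter_degree x + letter_degree y)
      (twist (letter_degree x) (letter_degree y))" for x y
    by (simp add: free_gen_def nf_mult nf_single twisted_mult_single)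
  have n3: "nf (scalar c * free_gen x * free_gen y) = Poly_Mapping.single (letter_degree x + letter_degree y)
      (c * twist (letter_degree x) (letter_degree y))" for c x y
    by (simp add: free_gen_def scalar_def nf_mult nf_single twisted_mult_single)
  have swap: "q powi (H $$ (i, j)) * twist (Poly_Mapping.single j 1) (Poly_Mapping.single i 1) =
      twist (Poly_Mapping.single i 1) (Poly_Mapping.single j 1)"
    if "i < n" "j < n" for i j
    using twist_swap[of "Poly_Mapping.single i 1" "Poly_Mapping.single j 1"] skew_form_single[OF that, of 1 1]
    by simp
  from assms show ?thesis
    unfolding laurent_rels_def
    by (elim UnE CollectE exE conjE) (simp_all add: nf_diff n2 n3 swap add.commute flip: single_add)
qed

lemma nf_rel_ideal: "f \<in> rel_ideal \<Longrightarrow> nf f = 0"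
  using free.genideal_minimal[OF nf_kernel_ideal] nf_laurent_rels laurent_rels_carrier
  by (auto simp: laurent_ideal_def)

section \<open>Congruence modulo the defining ideal\<close>

definition rel_eq :: "(gen fword \<Rightarrow>\<^sub>0 complex) \<Rightarrow> (gen fword \<Rightarrow>\<^sub>0 complex) \<Rightarrow> bool" (infix \<open>\<approx>\<close> 50) where
  "f \<approx> g \<longleftrightarrow> f \<in> carrier free \<and> g \<in> carrier free \<and> f - g \<in> rel_ideal"

lemma rel_ideal_add: "f \<in> rel_ideal \<Longrightarrow> g \<in> rel_ideal \<Longrightarrow> f + g \<in> rel_ideal"
  using rel_ideal.a_closed[of f g] by simp

lemma rel_ideal_uminus: "f \<in> rel_ideal \<Longrightarrow> - f \<in> rel_ideal"
  using rel_ideal.a_inv_closed[of f] rel_ideal.Icarr[of f] by simp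

lemma rel_eq_refl [simp]: "f \<approx> f \<longleftrightarrow> f \<in> carrier free"
  using rel_ideal.zero_closed by (auto simp: rel_eq_def)

lemma rel_eq_sym: "f \<approx> g \<Longrightarrow> g \<approx> f"
  using rel_ideal_uminus[of "f - g"] by (simp add: rel_eq_def)

lemma rel_eq_trans [trans]: "f \<approx> g \<Longrightarrow> g \<approx> h \<Longrightarrow> f \<approx> h"
  using rel_ideal_add[of "f - g" "g - h"] by (simp add: rel_eq_def)

lemma rel_eq_add: "f \<approx> f' \<Longrightarrow> g \<approx> g' \<Longrightarrow> f + g \<approx> f' + g'"
  using rel_ideal_add[of "f - f'" "g - g'"] by (simp add: rel_eq_def algebra_simps)

lemma rel_eq_mult:
  assumes "f \<approx> f'" "g \<approx> g'"
  shows "f * g \<approx> f' * g'"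
proof -
  have "(f - f') * g \<in> rel_ideal" "f' * (g - g') \<in> rel_ideal"
    using assms rel_ideal.I_r_closed[of "f - f'" g] rel_ideal.I_l_closed[of "g - g'" f']
    by (auto simp: rel_eq_def)
  then have "(f - f') * g + f' * (g - g') \<in> rel_ideal"
    by (rule rel_ideal_add)
  then show ?thesis using assms by (simp add: rel_eq_def algebra_simps)
qed

lemma rel_eq_nf: "f \<approx> g \<Longrightarrow> nf f = nf g"
  using nf_rel_ideal[of "f - g"] by (simp add: rel_eq_def nf_diff)

section \<open>Commutation up to a nonzero scalar\<close>

lemma scalar_comm: "f * scalar c = scalar c * f"
proof (induction f rule: poly_mapping_add_induct)
  case (single k a)
  then show ?case by (simp add: scalar_def mult_single mult.commute)
qed (simp_all add: algebra_simps)

lemma scalar_left_comm: "f * (scalar c * g) = scalar c * (f * g)"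
  by (metis mult.assoc scalar_comm)

lemma scalar_mult: "scalar c * scalar d = scalar (c * d)" and scalar_one: "scalar 1 = 1"
  by (simp_all add: scalar_def mult_single)

text \<open>The scalar stays existential: moving letters requires only that one exists, and
  \<open>nf\<close> determines the resulting factor afterwards.\<close>

definition q_commute :: "(gen fword \<Rightarrow>\<^sub>0 complex) \<Rightarrow> (gen fword \<Rightarrow>\<^sub>0 complex) \<Rightarrow> bool" where
  "q_commute f g \<longleftrightarrow> f \<in> carrier free \<and> g \<in> carrier free \<and> (\<exists>c. c \<noteq> 0 \<and> f * g \<approx> scalar c * (g * f))"

lemma q_commute_sym:
  assumes "q_commute f g"
  shows "q_commute g f"
proof -
  from assms obtain c where c: "f \<in> carrier free" "g \<in> carrier free" "c \<noteq> 0" "f * g \<approx> scalar c * (g * f)"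
    by (auto simp: q_commute_def)
  have "scalar (inverse c) * (f * g) \<approx> scalar (inverse c) * (scalar c * (g * f))"
    by (rule rel_eq_mult[OF _ c(4)]) simp
  moreover have "scalar (inverse c) * (scalar c * (g * f)) = g * f"
    using c by (simp flip: mult.assoc add: scalar_mult scalar_one)
  ultimately show ?thesis
    using c rel_eq_sym unfolding q_commute_def by (intro conjI exI[of _ "inverse c"]) auto
qed

text \<open>Multiply \<open>f g = c g f\<close> by \<open>g'\<close> on both sides to get
  \<open>g' f = c f g'\<close>. This reaches the inverse letters, about whose commutation the
  relations say nothing.\<close>

lemma q_commute_inverse:
  assumes "q_commute f g" "g' \<in> carrier free" "g * g' \<approx> 1" "g' * g \<approx> 1"
  shows "q_commute g' f"
proof -
  from assms obtain c where c: "f \<in> carrier free" "g \<in> carrier free" "c \<noteq> 0" "f * g \<approx> scalar c * (g * f)"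
    by (auto simp: q_commute_def)
  have "g' * f * 1 \<approx> g' * f * (g * g')"
    using c assms by (intro rel_eq_mult rel_eq_sym[OF assms(3)]) auto
  also have "g' * f * (g * g') = g' * (f * g) * g'"
    by (simp add: mult.assoc)
  also have "g' * (f * g) * g' \<approx> g' * (scalar c * (g * f)) * g'"
    using assms by (intro rel_eq_mult[OF rel_eq_mult[OF _ c(4)]]) auto
  also have "g' * (scalar c * (g * f)) * g' = scalar c * ((g' * g) * (f * g'))"
    by (metis mult.assoc scalar_comm)
  also have "scalar c * ((g' * g) * (f * g')) \<approx> scalar c * (1 * (f * g'))"
    using c assms by (intro rel_eq_mult) auto
  finally show ?thesis
    using c assms by (auto simp: q_commute_def)
qed

lemma q_commute_mult:
  assumes "q_commute f g" "q_commute f g'"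
  shows "q_commute f (g * g')"
proof -
  from assms obtain c c' where c: "f \<in> carrier free" "g \<in> carrier free" "c \<noteq> 0" "f * g \<approx> scalar c * (g * f)"
    and c': "g' \<in> carrier free" "c' \<noteq> 0" "f * g' \<approx> scalar c' * (g' * f)"
    by (auto simp: q_commute_def)
  have "(f * g) * g' \<approx> (scalar c * (g * f)) * g'"
    using c' by (intro rel_eq_mult[OF c(4)]) auto
  also have "(scalar c * (g * f)) * g' = scalar c * (g * (f * g'))"
    by (simp add: mult.assoc)
  also have "\<dots> \<approx> scalar c * (g * (scalar c' * (g' * f)))"
    using c by (intro rel_eq_mult[OF _ rel_eq_mult[OF _ c'(3)]]) auto
  also have "\<dots> = scalar (c * c') * (g * g' * f)"
    by (simp add: scalar_left_comm[of g] mult.assoc flip: scalar_mult)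
  finally show ?thesis
    using c c' unfolding q_commute_def by (intro conjI exI[of _ "c * c'"]) (auto simp: mult.assoc)
qed

section \<open>Reduction of words to scalar multiples of one another\<close>

fun letter_inverse :: "gen \<Rightarrow> gen" where
  "letter_inverse (Gen i) = Gen_inv i"
| "letter_inverse (Gen_inv i) = Gen i"

lemma letter_inverse_in_gens [simp]: "letter_inverse x \<in> gens n \<longleftrightarrow> x \<in> gens n"
  by (cases x) auto

lemma letter_degree_inverse [simp]: "letter_degree (letter_inverse x) = - letter_degree x"
  by (cases x) (auto simp: single_uminus)

lemma free_gen_carrier [simp]: "x \<in> gens n \<Longrightarrow> free_gen x \<in> carrier free"
  by (cases x) auto

lemma free_gen_inverse: "x \<in> gens n \<Longrightarrow> free_gen x * free_gen (letter_inverse x) \<approx> 1"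
  using laurent_rels_subset by (cases x) (auto simp: rel_eq_def laurent_rels_def)

lemma free_gen_inverse': "x \<in> gens n \<Longrightarrow> free_gen (letter_inverse x) * free_gen x \<approx> 1"
  using laurent_rels_subset by (cases x) (auto simp: rel_eq_def laurent_rels_def)

lemma q_commute_letter_inverse:
  assumes "q_commute f (free_gen x)" "x \<in> gens n"
  shows "q_commute f (free_gen (letter_inverse x))"
  using assms by (intro q_commute_sym[OF q_commute_inverse[OF assms(1)]] free_gen_inverse free_gen_inverse') auto

lemma q_commute_letters:
  assumes "x \<in> gens n" "y \<in> gens n"
  shows "q_commute (free_gen x) (free_gen y)"
proof -
  have gen: "q_commute (free_gen (Gen i)) (free_gen (Gen j))" if "i < n" "j < n" for i j
  proof -
    have "free_gen (Gen i) * free_gen (Gen j) - scalar (q powi (H $$ (i, j))) * free_gen (Gen j) * free_gen (Gen i)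
        \<in> laurent_rels q H"
      unfolding laurent_rels_def dim_row_H using that by blast
    with laurent_rels_subset
    have "free_gen (Gen i) * free_gen (Gen j) - scalar (q powi (H $$ (i, j))) * free_gen (Gen j) * free_gen (Gen i)
        \<in> rel_ideal" by blast
    then show ?thesis
      unfolding q_commute_def using that q_nonzero
      by (intro conjI exI[of _ "q powi (H $$ (i, j))"]) (auto simp: rel_eq_def mult.assoc)
  qed
  \<comment> \<open>This extends the second argument from generators to all letters; by symmetry the
    same step then serves the first argument.\<close>
  have *: "q_commute f (free_gen y)" if "\<And>j. j < n \<Longrightarrow> q_commute f (free_gen (Gen j))" "y \<in> gens n" for f y
    using that q_commute_letter_inverse[of f] by (cases y) force+
  show ?thesis
    using * gen assms q_commute_sym by metis
qed

lemma q_commute_word: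
  assumes "x \<in> gens n" "set xs \<subseteq> gens n"
  shows "q_commute (free_gen x) (Poly_Mapping.single (Word xs) 1)"
  using assms(2)
proof (induction xs)
  case Nil
  have "q_commute (free_gen x) 1"
    unfolding q_commute_def using assms by (intro conjI exI[of _ 1]) (auto simp: scalar_one)
  then show ?case by (simp flip: zero_fword_def)
next
  case (Cons y ys)
  have "Poly_Mapping.single (Word (y # ys)) (1::complex) = free_gen y * Poly_Mapping.single (Word ys) 1"
    by (simp add: free_gen_def mult_single plus_fword_def)
  with Cons assms q_commute_letters q_commute_mult show ?case by simp
qed

text \<open>Without the inverse letter, all contributions to the coordinate of \<open>x\<close> have
  the same sign, and that of \<open>x\<close> itself is not \<open>0\<close>, so the total could not
  vanish.\<close>

lemma letter_inverse_mem:
  assumes "word_degree (Word (x # xs)) = 0"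
  shows "letter_inverse x \<in> set xs"
proof (rule ccontr)
  assume no_inv: "letter_inverse x \<notin> set xs"
  show False
  proof (cases x)
    case (Gen i)
    then have "0 \<le> Poly_Mapping.lookup (word_degree (Word ys)) i" if "set ys \<subseteq> set xs" for ys
      using that no_inv
    proof (induction ys)
      case (Cons y ys)
      then show ?case by (cases y) (auto simp: lookup_add lookup_single when_def)
    qed simp
    from this[of xs] Gen assms show False
      by (auto simp: poly_mapping_eq_iff fun_eq_iff lookup_add lookup_single dest!: spec[of _ i])
  next
    case (Gen_inv i)
    then have "Poly_Mapping.lookup (word_degree (Word ys)) i \<le> 0" if "set ys \<subseteq> set xs" for ys
      using that no_inv
    proof (induction ys)
      case (Cons y ys)
      then show ?case by (cases y) (auto simp: lookup_add lookup_single when_def)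
    qed simp
    from this[of xs] Gen_inv assms show False
      by (auto simp: poly_mapping_eq_iff fun_eq_iff lookup_add lookup_single dest!: spec[of _ i])
  qed
qed

text \<open>In a word of degree \<open>0\<close> the inverse of the first letter occurs; the first letter can be moved next
  to it at the cost of a scalar, and the two cancel.\<close>

lemma word_degree_zero_imp_scalar:
  assumes "set xs \<subseteq> gens n" "word_degree (Word xs) = 0"
  shows "\<exists>c. Poly_Mapping.single (Word xs) 1 \<approx> scalar c"
  using assms
proof (induction "length xs" arbitrary: xs rule: less_induct)
  case less
  show ?case
  proof (cases xs)
    case Nil
    then have "Poly_Mapping.single (Word xs) 1 = scalar 1"
      by (simp add: scalar_def zero_fword_def)
    then show ?thesis by (intro exI[of _ 1]) simp
  next
    case (Cons x ys)
    with less.prems obtain as bs where ys: "ys = as @ letter_inverse x # bs"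
      using letter_inverse_mem by (metis split_list)
    have gens: "x \<in> gens n" "set as \<subseteq> gens n" "set bs \<subseteq> gens n"
      using less.prems Cons ys by auto
    let ?w = "\<lambda>xs. Poly_Mapping.single (Word xs) (1::complex)"
    have [simp]: "?w as \<in> carrier free" "?w bs \<in> carrier free"
      using gens by (simp_all add: carrier_free_single)
    obtain c where c: "free_gen x * ?w as \<approx> scalar c * (?w as * free_gen x)"
      using q_commute_word[OF gens(1,2)] by (auto simp: q_commute_def)
    have "word_degree (Word (as @ bs)) = 0"
      using less.prems Cons ys by (simp add: word_degree_def)
    with less.hyps[of "as @ bs"] gens Cons ys obtain c' where c': "?w (as @ bs) \<approx> scalar c'"
      by auto
    have "?w xs = (free_gen x * ?w as) * (free_gen (letter_inverse x) * ?w bs)"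
      by (simp add: free_gen_def mult_single plus_fword_def Cons ys)
    also have "\<dots> \<approx> (scalar c * (?w as * free_gen x)) * (free_gen (letter_inverse x) * ?w bs)"
      using gens by (intro rel_eq_mult c) auto
    also have "\<dots> = scalar c * ?w as * (free_gen x * free_gen (letter_inverse x)) * ?w bs"
      by (simp add: mult.assoc)
    also have "\<dots> \<approx> scalar c * ?w as * 1 * ?w bs"
      using gens by (intro rel_eq_mult free_gen_inverse) auto
    also have "\<dots> = scalar c * ?w (as @ bs)"
      by (simp add: mult.assoc mult_single plus_fword_def)
    also have "\<dots> \<approx> scalar c * scalar c'"
      by (intro rel_eq_mult c') auto
    finally show ?thesis by (auto simp: scalar_mult)
  qed
qed

definition word_inverse :: "gen list \<Rightarrow> gen list" where
  "word_inverse xs = rev (map letter_inverse xs)"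

lemma word_inverse:
  assumes "set xs \<subseteq> gens n"
  shows "set (word_inverse xs) \<subseteq> gens n" "word_degree (Word (word_inverse xs)) = - word_degree (Word xs)"
    "Poly_Mapping.single (Word (word_inverse xs)) 1 * Poly_Mapping.single (Word xs) 1 \<approx> 1"
proof -
  have inv: "set (word_inverse xs) \<subseteq> gens n" if "set xs \<subseteq> gens n" for xs
    using that by (auto simp: word_inverse_def)
  from inv[OF assms] show "set (word_inverse xs) \<subseteq> gens n" .
  show "word_degree (Word (word_inverse xs)) = - word_degree (Word xs)"
    by (induction xs) (simp_all add: word_inverse_def word_degree_def)
  let ?w = "\<lambda>xs. Poly_Mapping.single (Word xs) (1::complex)"
  show "?w (word_inverse xs) * ?w xs \<approx> 1"
    using assms
  proof (induction xs)
    case Nil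
    then show ?case by (simp add: word_inverse_def flip: zero_fword_def)
  next
    case (Cons x xs)
    then have [simp]: "?w (word_inverse xs) \<in> carrier free" "?w xs \<in> carrier free" "x \<in> gens n"
      using inv[of xs] by (simp_all add: carrier_free_single)
    have "?w (word_inverse (x # xs)) * ?w (x # xs) =
        ?w (word_inverse xs) * (free_gen (letter_inverse x) * free_gen x) * ?w xs"
      by (simp add: word_inverse_def free_gen_def mult_single plus_fword_def)
    also have "\<dots> \<approx> ?w (word_inverse xs) * 1 * ?w xs"
      by (intro rel_eq_mult free_gen_inverse') auto
    also have "\<dots> \<approx> 1" using Cons by simp
    finally show ?case .
  qed
qed

text \<open>The word \<open>xs\<close> followed by the inverse of \<open>ys\<close> has degree
  \<open>0\<close>, hence is a scalar; multiplying back by \<open>ys\<close> gives the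
  claim.\<close>

lemma same_degree_words:
  assumes "set xs \<subseteq> gens n" "set ys \<subseteq> gens n" "word_degree (Word xs) = word_degree (Word ys)"
  shows "\<exists>c. Poly_Mapping.single (Word xs) 1 \<approx> scalar c * Poly_Mapping.single (Word ys) 1"
proof -
  let ?w = "\<lambda>xs. Poly_Mapping.single (Word xs) (1::complex)"
  note inv = word_inverse[OF assms(2)]
  have [simp]: "?w xs \<in> carrier free" "?w ys \<in> carrier free"
    using assms by (simp_all add: carrier_free_single)
  have "word_degree (Word (xs @ word_inverse ys)) = 0"
    using inv(2) assms(3) by (simp add: word_degree_def)
  with word_degree_zero_imp_scalar[of "xs @ word_inverse ys"] inv(1) assms(1)
  obtain c where c: "?w (xs @ word_inverse ys) \<approx> scalar c" by auto
  have "?w xs * 1 \<approx> ?w xs * (?w (word_inverse ys) * ?w ys)"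
    by (intro rel_eq_mult rel_eq_sym[OF inv(3)]) simp
  also have "\<dots> = ?w (xs @ word_inverse ys) * ?w ys"
    by (simp add: mult_single plus_fword_def)
  also have "\<dots> \<approx> scalar c * ?w ys"
    by (intro rel_eq_mult c) simp
  finally show ?thesis by auto
qed

text \<open>\<open>T\<close> rebuilds an element from its normal form by means of one word per
  degree, divided by its weight. Consequently the normal form determines the congruence
  class.\<close>

lemma rel_eq_standard_form:
  obtains T where "\<And>g. g \<in> carrier free \<Longrightarrow> g \<approx> T (nf g)"
proof -
  \<comment> \<open>The choice is arbitrary at a degree that no word over \<open>gens n\<close>
    attains; \<open>word\<close> is evaluated below only at degrees of such words.\<close>
  define word where "word d = Word (SOME xs. set xs \<subseteq> gens n \<and> word_degree (Word xs) = d)" for d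
  have word: "set (letters (word (word_degree w))) \<subseteq> gens n \<and> word_degree (word (word_degree w)) = word_degree w"
    if "set (letters w) \<subseteq> gens n" for w
    using someI[of "\<lambda>xs. set xs \<subseteq> gens n \<and> word_degree (Word xs) = word_degree w" "letters w"] that
    by (simp add: word_def)
  define T :: "((nat \<Rightarrow>\<^sub>0 int) \<Rightarrow>\<^sub>0 complex) \<Rightarrow> (gen fword \<Rightarrow>\<^sub>0 complex)"
    where "T = lin_ext (\<lambda>d a. Poly_Mapping.single (word d) (a / word_coeff (word d)))"
  have T_add: "T (g + h) = T g + T h" for g h
    unfolding T_def by (rule lin_ext_add) (simp_all add: add_divide_distrib single_add)
  have T: "g \<approx> T (nf g)" if "g \<in> carrier free" for g
  proof -
    from that have "Poly_Mapping.keys g \<subseteq> {w. set (letters w) \<subseteq> gens n}"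
      by (auto simp: carrier_free)
    then show ?thesis
    proof (induction g rule: poly_mapping_induct_on)
      case (single w a)
      let ?v = "word (word_degree w)"
      have v: "set (letters ?v) \<subseteq> gens n" "word_degree ?v = word_degree w"
        using word single by auto
      obtain c where c: "Poly_Mapping.single w 1 \<approx> scalar c * Poly_Mapping.single ?v 1"
        using same_degree_words[of "letters w" "letters ?v"] single v by auto
      \<comment> \<open>Applying \<open>nf\<close> to the congruence identifies the unknown scalar
        \<open>c\<close> as the quotient of the two weights.\<close>
      from rel_eq_nf[OF c] v have "Poly_Mapping.single (word_degree w) (word_coeff w) =
          Poly_Mapping.single (word_degree w) (c * word_coeff ?v)"
        by (simp add: scalar_def mult_single nf_single)
      from arg_cong[OF this, of "\<lambda>f. Poly_Mapping.lookup f (word_degree w)"]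
      have "word_coeff w = c * word_coeff ?v" by simp
      moreover have "scalar a * Poly_Mapping.single w 1 \<approx> scalar a * (scalar c * Poly_Mapping.single ?v 1)"
        by (intro rel_eq_mult c) simp
      ultimately show ?case
        by (simp add: T_def nf_single lin_ext_single scalar_def mult_single)
    qed (simp_all add: T_add nf_add rel_eq_add, simp add: T_def)
  qed
  show thesis
    using T by (rule that)
qed

text \<open>Faithfulness of the model: elements with equal normal forms are both congruent to the
  same value of \<open>T\<close>.\<close>

theorem rel_eq_iff_nf:
  assumes "f \<in> carrier free" "g \<in> carrier free"
  shows "f \<approx> g \<longleftrightarrow> nf f = nf g"
proof
  assume "nf f = nf g"
  moreover obtain T where "f \<approx> T (nf f)" "g \<approx> T (nf g)"
    using rel_eq_standard_form assms by metis
  ultimately show "f \<approx> g" using rel_eq_sym rel_eq_trans by metis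
qed (rule rel_eq_nf)

section \<open>Homogeneous elements of the quantum Laurent algebra\<close>

abbreviation "L \<equiv> laurent q H"
abbreviation "cl \<equiv> laurent_class q H"
abbreviation "y \<equiv> y_gen q H"

lemma L_ops:
  "carrier L = carrier (free Quot rel_ideal)" "monoid.mult L = monoid.mult (free Quot rel_ideal)"
  "ring.add L = ring.add (free Quot rel_ideal)" "monoid.one L = monoid.one (free Quot rel_ideal)"
  "ring.zero L = ring.zero (free Quot rel_ideal)"
  "c \<odot>\<^bsub>L\<^esub> x = cl (scalar c) \<otimes>\<^bsub>L\<^esub> x"
  by (simp_all add: laurent_def laurent_quot_def)

sublocale Q: ring "free Quot rel_ideal"
  by (rule rel_ideal.quotient_is_ring)

sublocale L: ring L
proof (rule ringI)
  show "abelian_group L"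
    by (rule abelian_groupI) (auto simp: L_ops Q.a_ac intro: Q.a_inv_closed Q.l_neg)
  show "monoid L"
    by (rule monoidI) (auto simp: L_ops Q.m_assoc)
qed (auto simp: L_ops Q.l_distr Q.r_distr)

lemma cl_hom: "cl \<in> Ring.ring_hom free L"
  using rel_ideal.rcos_ring_hom unfolding laurent_class_def dim_row_H
  by (simp add: Ring.ring_hom_def L_ops)

lemma cl_simps [simp]:
  "f \<in> carrier free \<Longrightarrow> cl f \<in> carrier L"
  "f \<in> carrier free \<Longrightarrow> g \<in> carrier free \<Longrightarrow> cl f \<otimes>\<^bsub>L\<^esub> cl g = cl (f * g)"
  "f \<in> carrier free \<Longrightarrow> g \<in> carrier free \<Longrightarrow> cl f \<oplus>\<^bsub>L\<^esub> cl g = cl (f + g)"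
  "f \<in> carrier free \<Longrightarrow> c \<odot>\<^bsub>L\<^esub> cl f = cl (scalar c * f)"
  using ring_hom_memE[OF cl_hom] by (auto simp: L_ops(6))

lemma one_L: "\<one>\<^bsub>L\<^esub> = cl 1"
  using ring_hom_memE(4)[OF cl_hom] by simp

lemma cl_surj:
  assumes "x \<in> carrier L"
  obtains f where "f \<in> carrier free" "x = cl f"
  using assms
  by (auto simp: L_ops FactRing_def A_RCOSETS_def RCOSETS_def a_r_coset_def laurent_class_def)

lemma cl_eq_iff:
  assumes "f \<in> carrier free" "g \<in> carrier free"
  shows "cl f = cl g \<longleftrightarrow> nf f = nf g"
proof -
  have "f \<ominus>\<^bsub>free\<^esub> g = f - g"
    using assms by (simp add: a_minus_def)
  then show ?thesis
    using free.quotient_eq_iff_same_a_r_cos[OF rel_ideal.is_ideal assms] rel_eq_iff_nf[OF assms] assms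
    by (simp add: rel_eq_def laurent_class_def)
qed

section \<open>Scalar multiples and an induction rule for \<open>L\<close>\<close>

lemma smult_closed [simp]: "x \<in> carrier L \<Longrightarrow> c \<odot>\<^bsub>L\<^esub> x \<in> carrier L"
  by (erule cl_surj) simp

lemma smult_smult [simp]: "x \<in> carrier L \<Longrightarrow> c \<odot>\<^bsub>L\<^esub> (d \<odot>\<^bsub>L\<^esub> x) = (c * d) \<odot>\<^bsub>L\<^esub> x"
  by (erule cl_surj) (simp add: scalar_mult flip: mult.assoc)

lemma smult_one [simp]: "x \<in> carrier L \<Longrightarrow> 1 \<odot>\<^bsub>L\<^esub> x = x"
  by (erule cl_surj) (simp add: scalar_one)

lemma y_carrier [simp]: "i < n \<Longrightarrow> y i \<in> carrier L"
  by (simp add: y_gen_def)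

lemma laurent_induct [consumes 1, case_names one gen mult add smult]:
  assumes "x \<in> carrier L"
    and one: "P \<one>\<^bsub>L\<^esub>"
    and gen: "\<And>a. a \<in> gens n \<Longrightarrow> P (cl (free_gen a))"
    and mult: "\<And>u v. u \<in> carrier L \<Longrightarrow> v \<in> carrier L \<Longrightarrow> P u \<Longrightarrow> P v \<Longrightarrow> P (u \<otimes>\<^bsub>L\<^esub> v)"
    and add: "\<And>u v. u \<in> carrier L \<Longrightarrow> v \<in> carrier L \<Longrightarrow> P u \<Longrightarrow> P v \<Longrightarrow> P (u \<oplus>\<^bsub>L\<^esub> v)"
    and smult: "\<And>c u. u \<in> carrier L \<Longrightarrow> P u \<Longrightarrow> P (c \<odot>\<^bsub>L\<^esub> u)"
  shows "P x"
proof -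
  have word: "P (cl (Poly_Mapping.single (Word xs) 1))" if "set xs \<subseteq> gens n" for xs
    using that
  proof (induction xs)
    case Nil
    then show ?case using one by (simp add: one_L flip: zero_fword_def)
  next
    case (Cons a xs)
    then have [simp]: "Poly_Mapping.single (Word xs) (1::complex) \<in> carrier free"
      by (simp add: carrier_free_single)
    have "Poly_Mapping.single (Word (a # xs)) 1 = free_gen a * Poly_Mapping.single (Word xs) (1::complex)"
      by (simp add: free_gen_def mult_single plus_fword_def)
    then show ?case
      using mult[of "cl (free_gen a)" "cl (Poly_Mapping.single (Word xs) 1)"] Cons gen[of a] by simp
  qed
  have single: "P (cl (Poly_Mapping.single w c))" if "set (letters w) \<subseteq> gens n" for w c
  proof -
    have "Poly_Mapping.single w (1::complex) \<in> carrier free"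
      using that by (simp add: carrier_free_single)
    moreover have "Poly_Mapping.single w c = scalar c * Poly_Mapping.single w 1"
      by (simp add: scalar_def mult_single)
    ultimately show ?thesis
      using smult[of "cl (Poly_Mapping.single w 1)" c] word[of "letters w"] that by simp
  qed
  obtain f where f: "f \<in> carrier free" "x = cl f" using assms(1) by (rule cl_surj)
  then have "Poly_Mapping.keys f \<subseteq> {w. set (letters w) \<subseteq> gens n}"
    by (auto simp: carrier_free)
  then have "P (cl f)"
  proof (induction f rule: poly_mapping_induct_on)
    case (add f g)
    then have "f \<in> carrier free" "g \<in> carrier free"
      by (auto simp: carrier_free)
    with add assms(5)[of "cl f" "cl g"] show ?case by simp
  qed (use single single[of 0 0] in \<open>auto simp: zero_fword_def\<close>)
  with f show ?thesis by simp
qed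

text \<open>Nonzero multiples of a monomial, with the coefficient hidden. What is proved about them
  then involves degrees only.\<close>

definition homogeneous :: "(gen fword \<Rightarrow>\<^sub>0 complex) set \<Rightarrow> (nat \<Rightarrow>\<^sub>0 int) \<Rightarrow> bool" where
  "homogeneous x d \<longleftrightarrow> (\<exists>f\<in>carrier free. \<exists>a. a \<noteq> 0 \<and> x = cl f \<and> nf f = Poly_Mapping.single d a)"

lemma homogeneousE:
  assumes "homogeneous x d"
  obtains f a where "f \<in> carrier free" "a \<noteq> 0" "x = cl f" "nf f = Poly_Mapping.single d a"
  using assms by (auto simp: homogeneous_def)

lemma homogeneousI:
  "f \<in> carrier free \<Longrightarrow> a \<noteq> 0 \<Longrightarrow> nf f = Poly_Mapping.single d a \<Longrightarrow> homogeneous (cl f) d"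
  by (auto simp: homogeneous_def)

lemma homogeneous_carrier: "homogeneous x d \<Longrightarrow> x \<in> carrier L"
  by (auto simp: homogeneous_def)

lemma homogeneous_mult:
  assumes "homogeneous u d" "homogeneous v e"
  shows "homogeneous (u \<otimes>\<^bsub>L\<^esub> v) (d + e)"
proof -
  from assms obtain f a g b where
    "f \<in> carrier free" "a \<noteq> 0" "u = cl f" "nf f = Poly_Mapping.single d a"
    "g \<in> carrier free" "b \<noteq> 0" "v = cl g" "nf g = Poly_Mapping.single e b"
    by (elim homogeneousE)
  then show ?thesis
    using homogeneousI[of "f * g" "a * b * twist d e" "d + e"]
    by (simp add: nf_mult twisted_mult_single)
qed

lemma nf_scalar_mult:
  "nf f = Poly_Mapping.single d a \<Longrightarrow> nf (scalar c * f) = Poly_Mapping.single d (c * a)"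
  by (simp add: nf_mult scalar_def nf_single twisted_mult_single)

lemma homogeneous_smult:
  assumes "homogeneous u d" "c \<noteq> 0"
  shows "homogeneous (c \<odot>\<^bsub>L\<^esub> u) d"
proof -
  from assms(1) obtain f a where "f \<in> carrier free" "a \<noteq> 0" "u = cl f" "nf f = Poly_Mapping.single d a"
    by (elim homogeneousE)
  then show ?thesis
    using homogeneousI[of "scalar c * f" "c * a" d] assms(2) by (simp add: nf_scalar_mult)
qed

lemma single_eq_iff: "Poly_Mapping.single d a = Poly_Mapping.single e b \<longleftrightarrow> a = b \<and> d = e \<or> a = 0 \<and> b = 0"
  by (metis lookup_single_eq lookup_single_not_eq single_zero)

lemma homogeneous_unique:
  assumes "homogeneous u d" "homogeneous u e"
  shows "d = e"
proof -
  from assms obtain f a g b where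
    "f \<in> carrier free" "a \<noteq> 0" "u = cl f" "nf f = Poly_Mapping.single d a"
    "g \<in> carrier free" "b \<noteq> 0" "u = cl g" "nf g = Poly_Mapping.single e b"
    by (elim homogeneousE)
  moreover from this have "nf f = nf g"
    by (metis cl_eq_iff)
  ultimately show ?thesis by (simp add: single_eq_iff)
qed

text \<open>The homogeneous elements of one degree form a punctured line. The torus factor of an
  automorphism originates here.\<close>

lemma homogeneous_proportional:
  assumes "homogeneous u d" "homogeneous v d"
  obtains c where "c \<noteq> 0" "v = c \<odot>\<^bsub>L\<^esub> u"
proof -
  from assms obtain f a g b where fg:
    "f \<in> carrier free" "a \<noteq> 0" "u = cl f" "nf f = Poly_Mapping.single d a"
    "g \<in> carrier free" "b \<noteq> 0" "v = cl g" "nf g = Poly_Mapping.single d b"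
    by (elim homogeneousE)
  then have "cl g = cl (scalar (b / a) * f)"
    by (subst cl_eq_iff) (auto simp: nf_scalar_mult)
  with fg show thesis by (intro that[of "b / a"]) auto
qed

text \<open>Both products have degree \<open>d + e\<close>, and by \<open>twist_swap\<close> the
  ratio of their coefficients does not involve those of \<open>u\<close> and \<open>v\<close>. One
  direction verifies relations for a substitution, the other reads off the constraint on the matrix
  of an automorphism.\<close>

lemma homogeneous_swap_iff:
  assumes "homogeneous u d" "homogeneous v e"
  shows "u \<otimes>\<^bsub>L\<^esub> v = c \<odot>\<^bsub>L\<^esub> (v \<otimes>\<^bsub>L\<^esub> u) \<longleftrightarrow> c = q powi skew_form d e"
proof -
  from assms obtain f a g b where fg:
    "f \<in> carrier free" "a \<noteq> 0" "u = cl f" "nf f = Poly_Mapping.single d a"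
    "g \<in> carrier free" "b \<noteq> 0" "v = cl g" "nf g = Poly_Mapping.single e b"
    by (elim homogeneousE)
  have "nf (g * f) = Poly_Mapping.single (e + d) (b * a * twist e d)"
    using fg by (simp add: nf_mult twisted_mult_single)
  then have "nf (scalar c * (g * f)) = Poly_Mapping.single (d + e) (c * (b * a * twist e d))"
    by (simp add: nf_scalar_mult add.commute)
  moreover have "nf (f * g) = Poly_Mapping.single (d + e) (a * b * (q powi skew_form d e * twist e d))"
    using fg by (simp add: nf_mult twisted_mult_single twist_swap[of d e])
  ultimately show ?thesis
    using fg q_nonzero by (auto simp: cl_eq_iff single_eq_iff)
qed

lemma homogeneous_one: "homogeneous \<one>\<^bsub>L\<^esub> 0"
  unfolding one_L by (rule homogeneousI[of _ 1]) auto

lemma homogeneous_letter: "a \<in> gens n \<Longrightarrow> homogeneous (cl (free_gen a)) (letter_degree a)"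
  by (rule homogeneousI[of _ 1]) (auto simp: free_gen_def nf_single carrier_free)

lemma homogeneous_y: "i < n \<Longrightarrow> homogeneous (y i) (Poly_Mapping.single i 1)"
  using homogeneous_letter[of "Gen i"] by (simp add: y_gen_def)

lemma homogeneous_word:
  "set xs \<subseteq> gens n \<Longrightarrow> homogeneous (cl (Poly_Mapping.single (Word xs) 1)) (word_degree (Word xs))"
  by (rule homogeneousI[of _ "word_coeff (Word xs)"]) (auto simp: nf_single carrier_free)

text \<open>If no word of the representative had degree \<open>d\<close>, the coefficient of its
  normal form at \<open>d\<close> would be \<open>0\<close>. So \<open>d\<close> is realized by
  letters of \<open>gens n\<close>.\<close>

lemma homogeneous_imp_word:
  assumes "homogeneous u d"
  obtains xs where "set xs \<subseteq> gens n" "word_degree (Word xs) = d"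
proof -
  from assms obtain f a where f: "f \<in> carrier free" "a \<noteq> 0" "nf f = Poly_Mapping.single d a"
    by (elim homogeneousE)
  have "Poly_Mapping.lookup (nf f) d =
      (\<Sum>w\<in>Poly_Mapping.keys f. if word_degree w = d then Poly_Mapping.lookup f w * word_coeff w else 0)"
    by (simp add: nf_def lin_ext_def lookup_sum lookup_single when_def)
  moreover have "Poly_Mapping.lookup (nf f) d \<noteq> 0"
    using f by simp
  ultimately have "(\<Sum>w\<in>Poly_Mapping.keys f. if word_degree w = d then Poly_Mapping.lookup f w * word_coeff w else 0) \<noteq> 0"
    by simp
  then obtain w where "w \<in> Poly_Mapping.keys f" "word_degree w = d"
    by (rule sum.not_neutral_contains_not_neutral) (auto split: if_splits)
  with f show thesis by (intro that[of "letters w"]) (auto simp: carrier_free)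
qed

text \<open>Multiplied by \<open>twist (- d) (- d)\<close>, either side becomes \<open>1\<close>.
  This makes the inverse constructed next two-sided.\<close>

lemma twist_uminus: "twist d (- d) = twist (- d) d"
proof -
  have "twist d (- d) * twist (- d) (- d) = twist (- d) d * twist (- d) (- d)"
    using twist_add(1)[of d "- d" "- d"] twist_add(2)[of "- d" d "- d"] by simp
  then show ?thesis by simp
qed

lemma homogeneous_inverse:
  assumes "homogeneous u d"
  shows "u \<in> Units L" "homogeneous (inv\<^bsub>L\<^esub> u) (- d)"
proof -
  from assms obtain f a where f: "f \<in> carrier free" "a \<noteq> 0" "u = cl f" "nf f = Poly_Mapping.single d a"
    by (elim homogeneousE)
  obtain xs where xs: "set xs \<subseteq> gens n" "word_degree (Word xs) = d"
    using assms by (rule homogeneous_imp_word)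
  define w where "w = Word (word_inverse xs)"
  \<comment> \<open>The coefficient of \<open>f * g\<close> is
    \<open>a * (b * word_coeff w) * twist d (- d)\<close>, and \<open>b\<close> makes it
    \<open>1\<close>.\<close>
  define b where "b = inverse (a * word_coeff w * twist d (- d))"
  define g where "g = Poly_Mapping.single w b"
  have b: "b \<noteq> 0" using f by (simp add: b_def)
  have g: "g \<in> carrier free" "nf g = Poly_Mapping.single (- d) (b * word_coeff w)"
    using word_inverse[OF xs(1)] xs by (simp_all add: g_def w_def carrier_free_single nf_single)
  have "nf (f * g) = nf 1" "nf (g * f) = nf 1"
    using f by (simp_all add: nf_mult g twisted_mult_single b_def twist_uminus field_simps)
  then have fg: "cl f \<otimes>\<^bsub>L\<^esub> cl g = \<one>\<^bsub>L\<^esub>" "cl g \<otimes>\<^bsub>L\<^esub> cl f = \<one>\<^bsub>L\<^esub>"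
    using f g by (simp_all add: one_L cl_eq_iff)
  then show units: "u \<in> Units L"
    using f g by (auto simp: Units_def intro!: bexI[of _ "cl g"])
  have "inv\<^bsub>L\<^esub> u = cl g"
    using L.inv_unique[of "inv\<^bsub>L\<^esub> u" u "cl g"] units fg f g by simp
  then show "homogeneous (inv\<^bsub>L\<^esub> u) (- d)"
    using homogeneousI[OF g(1) _ g(2)] b by simp
qed

lemma inverse_homogeneous:
  assumes "homogeneous u d" "v \<in> carrier L" "u \<otimes>\<^bsub>L\<^esub> v = \<one>\<^bsub>L\<^esub>"
  shows "v = inv\<^bsub>L\<^esub> u" "homogeneous v (- d)"
proof -
  show "v = inv\<^bsub>L\<^esub> u"
    using L.inv_unique[of "inv\<^bsub>L\<^esub> u" u v] homogeneous_inverse[OF assms(1)] homogeneous_carrier[OF assms(1)] assms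
    by simp
  with homogeneous_inverse[OF assms(1)] show "homogeneous v (- d)" by simp
qed

text \<open>The linear order on degrees enters here, through \<open>twisted_mult_eq_oneD\<close>; a
  one-sided inverse is enough for that argument.\<close>

lemma invertible_imp_homogeneous:
  assumes "u \<in> carrier L" "v \<in> carrier L" "u \<otimes>\<^bsub>L\<^esub> v = \<one>\<^bsub>L\<^esub>"
  obtains d where "homogeneous u d"
proof -
  obtain f g where fg: "f \<in> carrier free" "u = cl f" "g \<in> carrier free" "v = cl g"
    using assms by (metis cl_surj)
  then have "nf (f * g) = nf 1"
    using assms(3) by (simp add: one_L cl_eq_iff)
  then have "twisted_mult twist (nf f) (nf g) = Poly_Mapping.single 0 1"
    by (simp add: nf_mult)
  with twisted_mult_eq_oneD[of twist "nf f" "nf g"] obtain d a where "a \<noteq> 0" "nf f = Poly_Mapping.single d a"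
    by (metis twist_nonzero)
  with fg homogeneousI show thesis using that by blast
qed

lemma homogeneous_nat_pow:
  assumes "homogeneous u (Poly_Mapping.single i a)"
  shows "homogeneous (u [^]\<^bsub>L\<^esub> (k::nat)) (Poly_Mapping.single i (int k * a))"
proof (induction k)
  case (Suc k)
  then show ?case
    using homogeneous_mult[OF Suc assms] by (simp add: algebra_simps flip: single_add)
qed (simp add: homogeneous_one)

lemma homogeneous_y_pow:
  assumes "i < n"
  shows "homogeneous (y i [^]\<^bsub>L\<^esub> (k::int)) (Poly_Mapping.single i k)"
proof (cases "k < 0")
  case True
  have "homogeneous (inv\<^bsub>L\<^esub> (y i [^]\<^bsub>L\<^esub> nat (- k))) (- Poly_Mapping.single i (int (nat (- k)) * 1))"
    by (rule homogeneous_inverse(2)[OF homogeneous_nat_pow[OF homogeneous_y[OF assms]]])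
  moreover have "- Poly_Mapping.single i (int (nat (- k)) * 1) = Poly_Mapping.single i k"
    using True by (simp flip: single_uminus)
  ultimately show ?thesis using True unfolding int_pow_def2 by simp
next
  case False
  have "homogeneous (y i [^]\<^bsub>L\<^esub> nat k) (Poly_Mapping.single i (int (nat k) * 1))"
    by (rule homogeneous_nat_pow[OF homogeneous_y[OF assms]])
  then show ?thesis using False unfolding int_pow_def2 by simp
qed

definition vec_degree :: "int vec \<Rightarrow> (nat \<Rightarrow>\<^sub>0 int)" where
  "vec_degree \<alpha> = (\<Sum>i<n. Poly_Mapping.single i (\<alpha> $ i))"

lemma lookup_vec_degree: "Poly_Mapping.lookup (vec_degree \<alpha>) i = (if i < n then \<alpha> $ i else 0)"
  by (simp add: vec_degree_def lookup_sum lookup_single when_def)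

lemma homogeneous_y_monomial: "homogeneous (y_monomial q H \<alpha>) (vec_degree \<alpha>)"
proof -
  have "homogeneous (foldr (\<lambda>i z. (y i [^]\<^bsub>L\<^esub> (\<alpha> $ i)) \<otimes>\<^bsub>L\<^esub> z) is \<one>\<^bsub>L\<^esub>)
      (\<Sum>i\<leftarrow>is. Poly_Mapping.single i (\<alpha> $ i))" if "set is \<subseteq> {..<n}" for "is"
    using that by (induction "is") (auto intro: homogeneous_one homogeneous_mult homogeneous_y_pow)
  from this[of "[0..<n]"] show ?thesis
    by (simp add: y_monomial_def vec_degree_def interv_sum_list_conv_sum_set_nat atLeast0LessThan)
qed

section \<open>Endomorphisms and automorphisms\<close>

text \<open>\<open>alg_aut\<close> without bijectivity: the universal property yields such maps, and
  bijectivity comes later from their composites.\<close>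

definition alg_end :: "((gen fword \<Rightarrow>\<^sub>0 complex) set \<Rightarrow> (gen fword \<Rightarrow>\<^sub>0 complex) set) set" where
  "alg_end = {\<phi> \<in> Ring.ring_hom L L \<inter> extensional (carrier L).
     \<forall>c. \<forall>x\<in>carrier L. \<phi> (c \<odot>\<^bsub>L\<^esub> x) = c \<odot>\<^bsub>L\<^esub> \<phi> x}"

lemma alg_aut_iff: "\<phi> \<in> alg_aut L \<longleftrightarrow> \<phi> \<in> alg_end \<and> bij_betw \<phi> (carrier L) (carrier L)"
  by (auto simp: alg_aut_def alg_end_def ring_iso_def)

lemma alg_endD:
  assumes "\<phi> \<in> alg_end"
  shows "x \<in> carrier L \<Longrightarrow> \<phi> x \<in> carrier L"
    "x \<in> carrier L \<Longrightarrow> x' \<in> carrier L \<Longrightarrow> \<phi> (x \<otimes>\<^bsub>L\<^esub> x') = \<phi> x \<otimes>\<^bsub>L\<^esub> \<phi> x'"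
    "x \<in> carrier L \<Longrightarrow> x' \<in> carrier L \<Longrightarrow> \<phi> (x \<oplus>\<^bsub>L\<^esub> x') = \<phi> x \<oplus>\<^bsub>L\<^esub> \<phi> x'"
    "\<phi> \<one>\<^bsub>L\<^esub> = \<one>\<^bsub>L\<^esub>" "x \<in> carrier L \<Longrightarrow> \<phi> (c \<odot>\<^bsub>L\<^esub> x) = c \<odot>\<^bsub>L\<^esub> \<phi> x" "\<phi> \<in> extensional (carrier L)"
  using assms by (auto simp: alg_end_def ring_hom_memE)

lemma alg_endI:
  assumes "\<And>x. x \<in> carrier L \<Longrightarrow> \<phi> x \<in> carrier L"
    "\<And>x x'. x \<in> carrier L \<Longrightarrow> x' \<in> carrier L \<Longrightarrow> \<phi> (x \<otimes>\<^bsub>L\<^esub> x') = \<phi> x \<otimes>\<^bsub>L\<^esub> \<phi> x'"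
    "\<And>x x'. x \<in> carrier L \<Longrightarrow> x' \<in> carrier L \<Longrightarrow> \<phi> (x \<oplus>\<^bsub>L\<^esub> x') = \<phi> x \<oplus>\<^bsub>L\<^esub> \<phi> x'"
    "\<phi> \<one>\<^bsub>L\<^esub> = \<one>\<^bsub>L\<^esub>" "\<And>c x. x \<in> carrier L \<Longrightarrow> \<phi> (c \<odot>\<^bsub>L\<^esub> x) = c \<odot>\<^bsub>L\<^esub> \<phi> x" "\<phi> \<in> extensional (carrier L)"
  shows "\<phi> \<in> alg_end"
  using assms by (auto simp: alg_end_def intro!: ring_hom_memI)

lemma alg_end_id: "(\<lambda>x\<in>carrier L. x) \<in> alg_end"
  by (rule alg_endI) auto

lemma alg_end_compose:
  assumes "\<phi> \<in> alg_end" "\<psi> \<in> alg_end"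
  shows "compose (carrier L) \<phi> \<psi> \<in> alg_end"
  using alg_endD[OF assms(1)] alg_endD[OF assms(2)]
  by (intro alg_endI) (auto simp: compose_def)

lemma alg_aut_compose:
  assumes "\<phi> \<in> alg_aut L" "\<psi> \<in> alg_aut L"
  shows "compose (carrier L) \<phi> \<psi> \<in> alg_aut L"
  using assms alg_end_compose bij_betw_compose by (auto simp: alg_aut_iff)

lemma alg_aut_inverse:
  assumes "\<phi> \<in> alg_aut L"
  obtains \<psi> where "\<psi> \<in> alg_aut L" "\<And>x. x \<in> carrier L \<Longrightarrow> \<phi> (\<psi> x) = x" "\<And>x. x \<in> carrier L \<Longrightarrow> \<psi> (\<phi> x) = x"
proof -
  define \<psi> where "\<psi> = (\<lambda>x\<in>carrier L. inv_into (carrier L) \<phi> x)"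
  from assms have \<phi>: "\<phi> \<in> alg_end" and bij: "bij_betw \<phi> (carrier L) (carrier L)"
    by (auto simp: alg_aut_iff)
  note D = alg_endD[OF \<phi>]
  have closed: "\<psi> x \<in> carrier L" and right: "\<phi> (\<psi> x) = x" if "x \<in> carrier L" for x
    using that bij by (auto simp: \<psi>_def bij_betw_def f_inv_into_f intro: inv_into_into)
  have inj: "u = v" if "u \<in> carrier L" "v \<in> carrier L" "\<phi> u = \<phi> v" for u v
    using that bij by (auto simp: bij_betw_def dest: inj_onD)
  have left: "\<psi> (\<phi> x) = x" if "x \<in> carrier L" for x
    using inj[of "\<psi> (\<phi> x)" x] that by (simp add: closed right D)
  have "\<psi> \<in> alg_end"
  proof (rule alg_endI)
    show "\<psi> \<in> extensional (carrier L)" by (simp add: \<psi>_def)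
    show "\<psi> \<one>\<^bsub>L\<^esub> = \<one>\<^bsub>L\<^esub>"
      using left[of "\<one>\<^bsub>L\<^esub>"] D by simp
    fix x assume x: "x \<in> carrier L"
    show "\<psi> x \<in> carrier L" by (rule closed[OF x])
    show "\<psi> (c \<odot>\<^bsub>L\<^esub> x) = c \<odot>\<^bsub>L\<^esub> \<psi> x" for c
      by (rule inj) (simp_all add: x closed right D)
    fix x' assume x': "x' \<in> carrier L"
    show "\<psi> (x \<otimes>\<^bsub>L\<^esub> x') = \<psi> x \<otimes>\<^bsub>L\<^esub> \<psi> x'" "\<psi> (x \<oplus>\<^bsub>L\<^esub> x') = \<psi> x \<oplus>\<^bsub>L\<^esub> \<psi> x'"
      by (rule inj; simp add: x x' closed right D)+
  qed
  moreover have "bij_betw \<psi> (carrier L) (carrier L)"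
    by (rule bij_betw_byWitness[where f' = \<phi>]) (auto simp: left right closed D)
  ultimately show thesis
    using that left right by (auto simp: alg_aut_iff)
qed

lemma letters_zero: "letters 0 = []"
  by (simp add: zero_fword_def)

lemma alg_end_inverse_letter:
  assumes "\<phi> \<in> alg_end" "i < n"
  shows "\<phi> (y i) \<otimes>\<^bsub>L\<^esub> \<phi> (cl (free_gen (Gen_inv i))) = \<one>\<^bsub>L\<^esub>"
    "\<phi> (cl (free_gen (Gen_inv i))) \<otimes>\<^bsub>L\<^esub> \<phi> (y i) = \<one>\<^bsub>L\<^esub>"
proof -
  have "y i \<otimes>\<^bsub>L\<^esub> cl (free_gen (Gen_inv i)) = \<one>\<^bsub>L\<^esub>" "cl (free_gen (Gen_inv i)) \<otimes>\<^bsub>L\<^esub> y i = \<one>\<^bsub>L\<^esub>"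
    using assms(2) rel_eq_nf free_gen_inverse[of "Gen i"] free_gen_inverse'[of "Gen i"]
    by (simp_all add: y_gen_def one_L cl_eq_iff)
  with alg_endD[OF assms(1)] assms(2) show
    "\<phi> (y i) \<otimes>\<^bsub>L\<^esub> \<phi> (cl (free_gen (Gen_inv i))) = \<one>\<^bsub>L\<^esub>"
    "\<phi> (cl (free_gen (Gen_inv i))) \<otimes>\<^bsub>L\<^esub> \<phi> (y i) = \<one>\<^bsub>L\<^esub>"
    by (metis cl_simps(1) carrier_freeI(9) y_carrier)+
qed

text \<open>Agreement on the \<open>y i\<close> spreads to the inverse letters, since their images
  are a left and a right inverse of the same element.\<close>

lemma alg_end_eqI:
  assumes "\<phi> \<in> alg_end" "\<psi> \<in> alg_end" "\<And>i. i < n \<Longrightarrow> \<phi> (y i) = \<psi> (y i)"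
  shows "\<phi> = \<psi>"
proof (rule extensionalityI)
  fix x assume "x \<in> carrier L"
  then show "\<phi> x = \<psi> x"
  proof (induction x rule: laurent_induct)
    case (gen a)
    show ?case
    proof (cases a)
      case (Gen i)
      with gen assms(3) show ?thesis by (simp add: y_gen_def)
    next
      case (Gen_inv i)
      let ?v = "cl (free_gen (Gen_inv i))"
      have "\<phi> ?v \<otimes>\<^bsub>L\<^esub> \<phi> (y i) = \<one>\<^bsub>L\<^esub>" "\<phi> (y i) \<otimes>\<^bsub>L\<^esub> \<psi> ?v = \<one>\<^bsub>L\<^esub>"
        using alg_end_inverse_letter[OF assms(1)] alg_end_inverse_letter[OF assms(2)] assms(3) gen Gen_inv
        by simp_all
      moreover have "\<phi> (y i) \<in> carrier L" "\<phi> ?v \<in> carrier L" "\<psi> ?v \<in> carrier L"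
        using gen Gen_inv alg_endD(1)[OF assms(1)] alg_endD(1)[OF assms(2)] by simp_all
      ultimately show ?thesis
        using L.inv_unique Gen_inv by blast
    qed
  qed (simp_all add: alg_endD[OF assms(1)] alg_endD[OF assms(2)])
qed (use assms alg_endD(6) in auto)

text \<open>A homogeneous element is a multiple of a word, and along a word the degrees of the
  images of the letters add up. The additive map \<open>A\<close> becomes
  \<open>mat_degree M\<close> in \<open>monomial_end_homogeneous\<close>.\<close>

lemma alg_end_homogeneous:
  assumes \<phi>: "\<phi> \<in> alg_end"
    and A: "\<And>d e. A (d + e) = A d + A e"
    and gen: "\<And>i. i < n \<Longrightarrow> homogeneous (\<phi> (y i)) (A (Poly_Mapping.single i 1))"
    and x: "homogeneous x d"
  shows "homogeneous (\<phi> x) (A d)"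
proof -
  note D = alg_endD[OF \<phi>]
  have A0: "A 0 = 0" using A[of 0 0] by simp
  have A_uminus: "A (- d) = - A d" for d
    using A[of d "- d"] A0 by (simp add: eq_neg_iff_add_eq_0 add.commute)
  have letter: "homogeneous (\<phi> (cl (free_gen a))) (A (letter_degree a))" if a: "a \<in> gens n" for a
  proof (cases a)
    case (Gen i)
    with gen a show ?thesis by (simp add: y_gen_def)
  next
    case (Gen_inv i)
    then have i: "i < n" using a by simp
    have "homogeneous (\<phi> (cl (free_gen (Gen_inv i)))) (- A (Poly_Mapping.single i 1))"
      using i alg_end_inverse_letter(1)[OF \<phi> i] by (intro inverse_homogeneous(2)[OF gen[OF i]] D(1)) simp_all
    then show ?thesis using Gen_inv by (simp add: A_uminus single_uminus)
  qed
  have word: "homogeneous (\<phi> (cl (Poly_Mapping.single (Word xs) 1))) (A (word_degree (Word xs)))"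
    if "set xs \<subseteq> gens n" for xs
    using that
  proof (induction xs)
    case Nil
    then show ?case
      using D(4) homogeneous_one A0 by (simp add: one_L flip: zero_fword_def)
  next
    case (Cons a xs)
    have "cl (Poly_Mapping.single (Word (a # xs)) 1) = cl (free_gen a) \<otimes>\<^bsub>L\<^esub> cl (Poly_Mapping.single (Word xs) 1)"
      using Cons.prems by (simp add: carrier_free_single) (simp add: free_gen_def mult_single plus_fword_def)
    moreover have "cl (free_gen a) \<in> carrier L" "cl (Poly_Mapping.single (Word xs) 1) \<in> carrier L"
      using Cons.prems by (simp_all add: carrier_free_single)
    ultimately have "\<phi> (cl (Poly_Mapping.single (Word (a # xs)) 1)) =
        \<phi> (cl (free_gen a)) \<otimes>\<^bsub>L\<^esub> \<phi> (cl (Poly_Mapping.single (Word xs) 1))"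
      by (simp only: D(2))
    with Cons letter[of a] show ?case
      by (simp add: A homogeneous_mult)
  qed
  obtain xs where xs: "set xs \<subseteq> gens n" "word_degree (Word xs) = d"
    using x by (rule homogeneous_imp_word)
  obtain c where "c \<noteq> 0" "x = c \<odot>\<^bsub>L\<^esub> cl (Poly_Mapping.single (Word xs) 1)"
    using homogeneous_proportional[OF homogeneous_word[OF xs(1)]] x xs(2) by metis
  then show ?thesis
    using word[OF xs(1)] xs D(5)[of "cl (Poly_Mapping.single (Word xs) 1)" c]
    by (simp add: carrier_free_single homogeneous_smult del: cl_simps(4))
qed

text \<open>The universal property: the substitution of representatives of the \<open>z i\<close> for the letters maps
  the defining relations into the defining ideal.\<close>

lemma alg_end_exists:
  assumes z: "\<And>i. i < n \<Longrightarrow> z i \<in> Units L"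
    and rel: "\<And>i j. i < n \<Longrightarrow> j < n \<Longrightarrow> z i \<otimes>\<^bsub>L\<^esub> z j = (q powi (H $$ (i, j))) \<odot>\<^bsub>L\<^esub> (z j \<otimes>\<^bsub>L\<^esub> z i)"
  obtains \<phi> where "\<phi> \<in> alg_end" "\<And>i. i < n \<Longrightarrow> \<phi> (y i) = z i"
proof -
  have "\<exists>f\<in>carrier free. cl f = x" if "x \<in> carrier L" for x
    using that by (metis cl_surj)
  then obtain r where r: "\<And>x. x \<in> carrier L \<Longrightarrow> r x \<in> carrier free" "\<And>x. x \<in> carrier L \<Longrightarrow> cl (r x) = x"
    by metis
  have zc: "z i \<in> carrier L" "inv\<^bsub>L\<^esub> z i \<in> carrier L" if "i < n" for i
    using z[OF that] by auto
  define img where "img a = (case a of Gen i \<Rightarrow> r (z i) | Gen_inv i \<Rightarrow> r (inv\<^bsub>L\<^esub> (z i)))" for a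
  have img: "img a \<in> carrier free" if "a \<in> gens n" for a
    using that zc r by (cases a) (auto simp: img_def)
  define subst where "subst = lin_ext (\<lambda>w c. scalar c * prod_list (map img (letters w)))"
  have zero: "subst 0 = 0" by (simp add: subst_def)
  have single: "subst (Poly_Mapping.single w c) = scalar c * prod_list (map img (letters w))" for w c
    by (simp add: subst_def lin_ext_single scalar_def)
  have add: "subst (f + g) = subst f + subst g" for f g
    unfolding subst_def by (rule lin_ext_add) (simp_all add: scalar_def single_add algebra_simps)
  have mult: "subst (f * g) = subst f * subst g" for f g
    unfolding subst_def
  proof (rule lin_ext_mult)
    fix u v :: "gen fword" and a b :: complex
    let ?U = "prod_list (map img (letters u))" and ?V = "prod_list (map img (letters v))"
    have "scalar a * ?U * (scalar b * ?V) = scalar a * scalar b * (?U * ?V)"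
      by (simp only: mult.assoc scalar_left_comm[of ?U])
    then show "scalar (a * b) * prod_list (map img (letters (u + v))) = scalar a * ?U * (scalar b * ?V)"
      by (simp add: scalar_mult plus_fword_def)
  qed (simp_all add: algebra_simps scalar_def single_add)
  have subst_one: "subst 1 = 1"
    using single[of 0 1] by (simp add: scalar_one letters_zero)
  have subst_scalar: "subst (scalar c) = scalar c" for c
    using single[of 0 c] by (simp add: scalar_def letters_zero)
  have subst_gen: "subst (free_gen a) = img a" for a
    by (simp add: free_gen_def single scalar_one)
  have subst_uminus: "subst (- f) = - subst f" for f
    using add[of f "- f"] by (simp add: eq_neg_iff_add_eq_0 add.commute zero)
  have closed: "subst f \<in> carrier free" if f: "f \<in> carrier free" for f
  proof -
    from f have "Poly_Mapping.keys f \<subseteq> {w. set (letters w) \<subseteq> gens n}"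
      by (auto simp: carrier_free)
    then show ?thesis
    proof (induction f rule: poly_mapping_induct_on)
      case (single w c)
      have "prod_list (map img xs) \<in> carrier free" if "set xs \<subseteq> gens n" for xs
        using that by (induction xs) (auto simp: img)
      with single show ?case by (simp add: \<open>subst (Poly_Mapping.single w c) = _\<close>)
    qed (simp_all add: add zero)
  qed
  \<comment> \<open>On the carrier, \<open>nf (subst f) = 0\<close> says that \<open>subst f\<close>
    lies in \<open>rel_ideal\<close>; thus \<open>?K\<close> is the kernel of the map to
    \<open>L\<close> that \<open>subst\<close> induces.\<close>
  let ?K = "{f \<in> carrier free. nf (subst f) = 0}"
  have "ideal ?K free"
  proof (rule idealI[OF ring_free_algebra])
    show "subgroup ?K (add_monoid free)"
      by (rule free.add.subgroupI) (auto simp: nf_add add subst_uminus zero intro!: exI[of _ 0])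
  qed (auto simp: nf_mult mult)
  moreover have "laurent_rels q H \<subseteq> ?K"
  proof -
    have inv: "nf (img (Gen i) * img (Gen_inv i)) = nf 1" "nf (img (Gen_inv i) * img (Gen i)) = nf 1" if "i < n" for i
    proof -
      have "cl (img (Gen i)) \<otimes>\<^bsub>L\<^esub> cl (img (Gen_inv i)) = \<one>\<^bsub>L\<^esub>"
        "cl (img (Gen_inv i)) \<otimes>\<^bsub>L\<^esub> cl (img (Gen i)) = \<one>\<^bsub>L\<^esub>"
        using r zc[OF that] z[OF that] by (simp_all add: img_def del: cl_simps(2))
      then have "cl (img (Gen i) * img (Gen_inv i)) = cl 1" "cl (img (Gen_inv i) * img (Gen i)) = cl 1"
        using img that by (simp_all add: one_L)
      then show "nf (img (Gen i) * img (Gen_inv i)) = nf 1" "nf (img (Gen_inv i) * img (Gen i)) = nf 1"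
        using that by (simp_all add: cl_eq_iff img)
    qed
    have comm: "nf (img (Gen i) * img (Gen j)) = nf (scalar (q powi (H $$ (i, j))) * img (Gen j) * img (Gen i))"
      if "i < n" "j < n" for i j
    proof -
      have "cl (r (z i)) \<otimes>\<^bsub>L\<^esub> cl (r (z j)) = (q powi (H $$ (i, j))) \<odot>\<^bsub>L\<^esub> (cl (r (z j)) \<otimes>\<^bsub>L\<^esub> cl (r (z i)))"
        using rel[OF that] r zc that by (simp del: cl_simps)
      then show ?thesis
        using r(1) zc that by (simp add: cl_eq_iff img_def mult.assoc)
    qed
    have diff: "subst (f - g) = subst f - subst g" for f g
      using add[of f "- g"] by (simp add: subst_uminus)
    show ?thesis
      unfolding laurent_rels_def dim_row_H
      by (intro subsetI, elim UnE CollectE exE conjE)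
         (simp_all add: diff mult nf_diff subst_gen subst_one subst_scalar inv comm)
  qed
  ultimately have "rel_ideal \<subseteq> ?K"
    unfolding laurent_ideal_def dim_row_H by (rule free.genideal_minimal)
  \<comment> \<open>The class of \<open>subst f\<close> depends only on the class of
    \<open>f\<close>, so the representatives chosen by \<open>r\<close> do not matter.\<close>
  then have subst_cong: "cl (subst f) = cl (subst g)" if "f \<in> carrier free" "g \<in> carrier free" "cl f = cl g" for f g
  proof -
    have "f - g \<in> rel_ideal"
      using that rel_eq_iff_nf cl_eq_iff by (simp add: rel_eq_def)
    then have "nf (subst (f + - g)) = 0" using \<open>rel_ideal \<subseteq> ?K\<close> by auto
    then show ?thesis
      using that closed by (simp only: cl_eq_iff add subst_uminus nf_add nf_minus) simp
  qed
  define \<phi> where "\<phi> = (\<lambda>x\<in>carrier L. cl (subst (r x)))"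
  have \<phi>_cl: "\<phi> (cl f) = cl (subst f)" if "f \<in> carrier free" for f
    using subst_cong[of "r (cl f)" f] that r by (simp add: \<phi>_def)
  have "\<phi> \<in> alg_end"
  proof (rule alg_endI)
    show "\<phi> \<in> extensional (carrier L)" by (simp add: \<phi>_def)
    show "\<phi> \<one>\<^bsub>L\<^esub> = \<one>\<^bsub>L\<^esub>" by (simp add: one_L \<phi>_cl subst_one)
    fix x assume "x \<in> carrier L"
    then obtain f where f: "f \<in> carrier free" "x = cl f" by (rule cl_surj)
    show "\<phi> x \<in> carrier L" using f closed by (simp add: \<phi>_cl)
    show "\<phi> (c \<odot>\<^bsub>L\<^esub> x) = c \<odot>\<^bsub>L\<^esub> \<phi> x" for c
      using f closed by (simp add: \<phi>_cl mult subst_scalar)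
    fix x' assume "x' \<in> carrier L"
    then obtain g where g: "g \<in> carrier free" "x' = cl g" by (rule cl_surj)
    show "\<phi> (x \<otimes>\<^bsub>L\<^esub> x') = \<phi> x \<otimes>\<^bsub>L\<^esub> \<phi> x'" "\<phi> (x \<oplus>\<^bsub>L\<^esub> x') = \<phi> x \<oplus>\<^bsub>L\<^esub> \<phi> x'"
      using f g closed by (simp_all add: \<phi>_cl mult add)
  qed
  moreover have "\<phi> (y i) = z i" if "i < n" for i
    using that zc r by (simp add: y_gen_def \<phi>_cl subst_gen img_def)
  ultimately show thesis using that by blast
qed

section \<open>Scalings of the generators and a criterion for bijectivity\<close>

lemma compose_idI:
  assumes "\<phi> \<in> alg_end" "\<psi> \<in> alg_end" "\<And>i. i < n \<Longrightarrow> \<phi> (\<psi> (y i)) = y i" "x \<in> carrier L"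
  shows "\<phi> (\<psi> x) = x"
proof -
  have "compose (carrier L) \<phi> \<psi> = (\<lambda>x\<in>carrier L. x)"
    using assms by (intro alg_end_eqI alg_end_compose alg_end_id) (simp_all add: compose_def)
  from fun_cong[OF this, of x] show ?thesis
    using assms(4) by (simp add: compose_def)
qed

lemma scaling_end_exists:
  assumes "\<And>i. i < n \<Longrightarrow> c i \<noteq> 0"
  obtains \<phi> where "\<phi> \<in> alg_end" "\<And>i. i < n \<Longrightarrow> \<phi> (y i) = c i \<odot>\<^bsub>L\<^esub> y i"
proof -
  have hom: "homogeneous (c i \<odot>\<^bsub>L\<^esub> y i) (Poly_Mapping.single i 1)" if "i < n" for i
    using that assms homogeneous_smult homogeneous_y by blast
  show thesis
  proof (rule alg_end_exists[of "\<lambda>i. c i \<odot>\<^bsub>L\<^esub> y i"])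
    show "c i \<odot>\<^bsub>L\<^esub> y i \<in> Units L" if "i < n" for i
      using homogeneous_inverse(1)[OF hom[OF that]] .
    show "(c i \<odot>\<^bsub>L\<^esub> y i) \<otimes>\<^bsub>L\<^esub> (c j \<odot>\<^bsub>L\<^esub> y j) =
        (q powi (H $$ (i, j))) \<odot>\<^bsub>L\<^esub> ((c j \<odot>\<^bsub>L\<^esub> y j) \<otimes>\<^bsub>L\<^esub> (c i \<odot>\<^bsub>L\<^esub> y i))"
      if "i < n" "j < n" for i j
      using homogeneous_swap_iff[OF hom[OF that(1)] hom[OF that(2)]] skew_form_single[OF that, of 1 1]
      by simp
  qed (rule that)
qed

text \<open>Each \<open>y i\<close> is sent to a nonzero multiple of itself by proportionality, so
  scaling by the inverse factors is the inverse map.\<close>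

lemma scaling_is_aut:
  assumes \<phi>: "\<phi> \<in> alg_end" and hom: "\<And>i. i < n \<Longrightarrow> homogeneous (\<phi> (y i)) (Poly_Mapping.single i 1)"
  shows "\<phi> \<in> alg_aut L"
proof -
  have "\<exists>c. c \<noteq> 0 \<and> \<phi> (y i) = c \<odot>\<^bsub>L\<^esub> y i" if "i < n" for i
    using homogeneous_proportional[OF homogeneous_y[OF that] hom[OF that]] by metis
  then obtain c where c: "\<And>i. i < n \<Longrightarrow> c i \<noteq> 0" "\<And>i. i < n \<Longrightarrow> \<phi> (y i) = c i \<odot>\<^bsub>L\<^esub> y i"
    by metis
  obtain \<psi> where \<psi>: "\<psi> \<in> alg_end" "\<And>i. i < n \<Longrightarrow> \<psi> (y i) = inverse (c i) \<odot>\<^bsub>L\<^esub> y i"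
    using scaling_end_exists[of "\<lambda>i. inverse (c i)"] c(1) by auto
  have "\<phi> (\<psi> x) = x" if "x \<in> carrier L" for x
    by (rule compose_idI[OF \<phi> \<psi>(1) _ that]) (simp add: c \<psi>(2) alg_endD(5)[OF \<phi>])
  moreover have "\<psi> (\<phi> x) = x" if "x \<in> carrier L" for x
    by (rule compose_idI[OF \<psi>(1) \<phi> _ that]) (simp add: c \<psi>(2) alg_endD(5)[OF \<psi>(1)])
  ultimately have "bij_betw \<phi> (carrier L) (carrier L)"
    using alg_endD(1)[OF \<phi>] alg_endD(1)[OF \<psi>(1)] by (intro bij_betw_byWitness[where f' = \<psi>]) auto
  with \<phi> show ?thesis by (simp add: alg_aut_iff)
qed

text \<open>Both composites are bijective by \<open>scaling_is_aut\<close>; \<open>\<psi>\<close>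
  after \<open>\<phi>\<close> gives injectivity of \<open>\<phi>\<close>, and \<open>\<phi>\<close>
  after \<open>\<psi>\<close> gives surjectivity.\<close>

lemma alg_autI:
  assumes \<phi>: "\<phi> \<in> alg_end" and \<psi>: "\<psi> \<in> alg_end"
    and "\<And>i. i < n \<Longrightarrow> homogeneous (\<phi> (\<psi> (y i))) (Poly_Mapping.single i 1)"
    and "\<And>i. i < n \<Longrightarrow> homogeneous (\<psi> (\<phi> (y i))) (Poly_Mapping.single i 1)"
  shows "\<phi> \<in> alg_aut L"
proof -
  have "compose (carrier L) \<phi> \<psi> \<in> alg_aut L" "compose (carrier L) \<psi> \<phi> \<in> alg_aut L"
    using assms by (intro scaling_is_aut alg_end_compose; simp add: compose_def)+
  then have bij: "bij_betw (compose (carrier L) \<phi> \<psi>) (carrier L) (carrier L)"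
    "bij_betw (compose (carrier L) \<psi> \<phi>) (carrier L) (carrier L)"
    by (simp_all add: alg_aut_iff)
  have "bij_betw \<phi> (carrier L) (carrier L)"
    unfolding bij_betw_def
  proof
    show "inj_on \<phi> (carrier L)"
    proof (rule inj_onI)
      fix u v assume "u \<in> carrier L" "v \<in> carrier L" "\<phi> u = \<phi> v"
      with bij_betw_imp_inj_on[OF bij(2)] show "u = v"
        by (auto simp: compose_def dest: inj_onD[of _ _ u v])
    qed
    have "v \<in> \<phi> ` carrier L" if v: "v \<in> carrier L" for v
    proof -
      have "v \<in> compose (carrier L) \<phi> \<psi> ` carrier L"
        using bij_betw_imp_surj_on[OF bij(1)] v by simp
      then obtain u where "u \<in> carrier L" "v = \<phi> (\<psi> u)" by (auto simp: compose_def)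
      with alg_endD(1)[OF \<psi>] show ?thesis by blast
    qed
    then show "\<phi> ` carrier L = carrier L" using alg_endD(1)[OF \<phi>] by blast
  qed
  with \<phi> show ?thesis by (simp add: alg_aut_iff)
qed

lemma tau_scal_unique:
  assumes "c \<in> torus n"
  shows "\<exists>!\<tau>. is_tau_scal q H c \<tau>"
proof -
  obtain \<phi> where \<phi>: "\<phi> \<in> alg_end" "\<And>i. i < n \<Longrightarrow> \<phi> (y i) = (c $ i) \<odot>\<^bsub>L\<^esub> y i"
    using assms by (auto simp: torus_def intro: scaling_end_exists[of "($) c"])
  have "\<phi> \<in> alg_aut L"
    using \<phi> assms by (intro scaling_is_aut) (auto simp: torus_def intro!: homogeneous_smult homogeneous_y)
  then have "is_tau_scal q H c \<phi>" using \<phi> by (simp add: is_tau_scal_def)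
  moreover have "\<tau> = \<phi>" if "is_tau_scal q H c \<tau>" for \<tau>
    using that \<phi> by (intro alg_end_eqI) (auto simp: is_tau_scal_def alg_aut_iff)
  ultimately show ?thesis by blast
qed

lemma tau_mat_unique:
  "is_tau_mat q H M \<tau> \<Longrightarrow> is_tau_mat q H M \<tau>' \<Longrightarrow> \<tau> = \<tau>'"
  by (rule alg_end_eqI) (auto simp: is_tau_mat_def alg_aut_iff)

section \<open>Automorphisms and integer matrices\<close>

definition mat_degree :: "int mat \<Rightarrow> (nat \<Rightarrow>\<^sub>0 int) \<Rightarrow> (nat \<Rightarrow>\<^sub>0 int)" where
  "mat_degree M d = (\<Sum>k<n. Poly_Mapping.single k (\<Sum>j<n. M $$ (k, j) * Poly_Mapping.lookup d j))"

lemma lookup_mat_degree: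
  "Poly_Mapping.lookup (mat_degree M d) k = (if k < n then \<Sum>j<n. M $$ (k, j) * Poly_Mapping.lookup d j else 0)"
  by (simp add: mat_degree_def lookup_sum lookup_single when_def)

lemma mat_degree_add: "mat_degree M (d + e) = mat_degree M d + mat_degree M e"
  by (rule poly_mapping_eqI) (simp add: lookup_mat_degree lookup_add distrib_left sum.distrib)

lemma mat_degree_single:
  assumes "M \<in> carrier_mat n n" "i < n"
  shows "mat_degree M (Poly_Mapping.single i 1) = vec_degree (col M i)"
proof (rule poly_mapping_eqI)
  fix k
  have "(\<Sum>j<n. M $$ (k, j) * Poly_Mapping.lookup (Poly_Mapping.single i 1) j) =
      (\<Sum>j<n. if j = i then M $$ (k, i) else 0)"
    by (intro sum.cong refl) (auto simp: lookup_single when_def)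
  then show "Poly_Mapping.lookup (mat_degree M (Poly_Mapping.single i 1)) k = Poly_Mapping.lookup (vec_degree (col M i)) k"
    using assms by (auto simp: lookup_mat_degree lookup_vec_degree)
qed

lemma mat_degree_mult:
  assumes "M \<in> carrier_mat n n" "N \<in> carrier_mat n n"
  shows "mat_degree (M * N) d = mat_degree M (mat_degree N d)"
proof (rule poly_mapping_eqI)
  fix k
  have "(\<Sum>j<n. (M * N) $$ (k, j) * Poly_Mapping.lookup d j) =
      (\<Sum>i<n. M $$ (k, i) * (\<Sum>j<n. N $$ (i, j) * Poly_Mapping.lookup d j))" if "k < n"
  proof -
    have "(\<Sum>j<n. (M * N) $$ (k, j) * Poly_Mapping.lookup d j) =
        (\<Sum>j<n. \<Sum>i<n. M $$ (k, i) * N $$ (i, j) * Poly_Mapping.lookup d j)"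
      using assms that by (intro sum.cong refl) (auto simp: scalar_prod_def sum_distrib_right atLeast0LessThan)
    also have "\<dots> = (\<Sum>i<n. \<Sum>j<n. M $$ (k, i) * N $$ (i, j) * Poly_Mapping.lookup d j)"
      by (rule sum.swap)
    finally show ?thesis by (simp add: sum_distrib_left mult.assoc)
  qed
  then show "Poly_Mapping.lookup (mat_degree (M * N) d) k = Poly_Mapping.lookup (mat_degree M (mat_degree N d)) k"
    by (auto simp: lookup_mat_degree)
qed

lemma vec_degree_unit_vec: "i < n \<Longrightarrow> vec_degree (unit_vec n i) = Poly_Mapping.single i 1"
  by (rule poly_mapping_eqI) (auto simp: lookup_vec_degree lookup_single when_def)

lemma vec_degree_col_mult:
  assumes "M \<in> carrier_mat n n" "N \<in> carrier_mat n n" "i < n"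
  shows "vec_degree (col (M * N) i) = mat_degree M (vec_degree (col N i))"
  using assms mat_degree_mult[OF assms(1,2), of "Poly_Mapping.single i 1"] mat_degree_single[of "M * N" i]
  by (metis mat_degree_single mult_carrier_mat)

lemma vec_degree_col_eqI:
  assumes "M \<in> carrier_mat n n" "N \<in> carrier_mat n n"
    and "\<And>i. i < n \<Longrightarrow> vec_degree (col M i) = vec_degree (col N i)"
  shows "M = N"
proof (rule eq_matI)
  fix i j assume "i < dim_row N" "j < dim_col N"
  then show "M $$ (i, j) = N $$ (i, j)"
    using arg_cong[OF assms(3)[of j], of "\<lambda>d. Poly_Mapping.lookup d i"] assms(1,2)
    by (auto simp: lookup_vec_degree)
qed (use assms in auto)

section \<open>Matrices that respect the commutation relations\<close>

lemma skew_form_cols: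
  assumes "M \<in> carrier_mat n n" "i < n" "j < n"
  shows "skew_form (vec_degree (col M i)) (vec_degree (col M j)) = (transpose_mat M * H * M) $$ (i, j)"
proof -
  have "(transpose_mat M * H * M) $$ (i, j) = (\<Sum>b<n. (\<Sum>a<n. M $$ (a, i) * H $$ (a, b)) * M $$ (b, j))"
    using assms by (simp add: scalar_prod_def atLeast0LessThan carrier_matD(2)[OF H_carrier])
  also have "\<dots> = (\<Sum>b<n. \<Sum>a<n. H $$ (a, b) * M $$ (a, i) * M $$ (b, j))"
    by (simp add: sum_distrib_left mult_ac)
  also have "\<dots> = (\<Sum>a<n. \<Sum>b<n. H $$ (a, b) * M $$ (a, i) * M $$ (b, j))"
    by (rule sum.swap)
  also have "\<dots> = skew_form (vec_degree (col M i)) (vec_degree (col M j))"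
    using assms unfolding skew_form_def by (intro sum.cong refl) (auto simp: lookup_vec_degree)
  finally show ?thesis ..
qed

text \<open>Phrased with powers of \<open>q\<close> because the locale assumes only that
  \<open>q\<close> is nonzero; the congruence modulo \<open>l\<close> appears once \<open>q\<close>
  is a primitive root. Invertibility of \<open>M\<close> is kept apart since the universal property
  does not ask for it.\<close>

definition preserves_form :: "int mat \<Rightarrow> bool" where
  "preserves_form M \<longleftrightarrow> M \<in> carrier_mat n n \<and>
     (\<forall>i<n. \<forall>j<n. q powi ((transpose_mat M * H * M) $$ (i, j)) = q powi (H $$ (i, j)))"

lemma monomial_end_exists:
  assumes "preserves_form M"
  obtains \<phi> where "\<phi> \<in> alg_end" "\<And>i. i < n \<Longrightarrow> \<phi> (y i) = y_monomial q H (col M i)"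
proof (rule alg_end_exists[of "\<lambda>i. y_monomial q H (col M i)"])
  show "y_monomial q H (col M i) \<in> Units L" for i
    by (rule homogeneous_inverse(1)[OF homogeneous_y_monomial])
  show "y_monomial q H (col M i) \<otimes>\<^bsub>L\<^esub> y_monomial q H (col M j) =
      (q powi (H $$ (i, j))) \<odot>\<^bsub>L\<^esub> (y_monomial q H (col M j) \<otimes>\<^bsub>L\<^esub> y_monomial q H (col M i))"
    if "i < n" "j < n" for i j
    using homogeneous_swap_iff[OF homogeneous_y_monomial homogeneous_y_monomial] assms that skew_form_cols[of M i j]
    by (auto simp: preserves_form_def)
qed (rule that)

lemma monomial_end_homogeneous:
  assumes "M \<in> carrier_mat n n" "\<phi> \<in> alg_end"
    and "\<And>i. i < n \<Longrightarrow> homogeneous (\<phi> (y i)) (vec_degree (col M i))" "homogeneous x d"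
  shows "homogeneous (\<phi> x) (mat_degree M d)"
  by (rule alg_end_homogeneous[OF assms(2) mat_degree_add _ assms(4)])
     (simp add: mat_degree_single[OF assms(1)] assms(3))

text \<open>The substitution for \<open>M'\<close> inverts that for \<open>M\<close> on degrees,
  though possibly not exactly; this is the situation that \<open>alg_autI\<close> covers.\<close>

lemma tau_mat_exists:
  assumes "preserves_form M" "preserves_form M'" "M * M' = 1\<^sub>m n" "M' * M = 1\<^sub>m n"
  obtains \<tau> where "is_tau_mat q H M \<tau>"
proof -
  have M: "M \<in> carrier_mat n n" "M' \<in> carrier_mat n n"
    using assms by (simp_all add: preserves_form_def)
  obtain \<phi> where \<phi>: "\<phi> \<in> alg_end" "\<And>i. i < n \<Longrightarrow> \<phi> (y i) = y_monomial q H (col M i)"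
    using monomial_end_exists[OF assms(1)] by blast
  obtain \<psi> where \<psi>: "\<psi> \<in> alg_end" "\<And>i. i < n \<Longrightarrow> \<psi> (y i) = y_monomial q H (col M' i)"
    using monomial_end_exists[OF assms(2)] by blast
  have inv: "mat_degree M (vec_degree (col M' i)) = Poly_Mapping.single i 1"
    "mat_degree M' (vec_degree (col M i)) = Poly_Mapping.single i 1" if "i < n" for i
    using vec_degree_col_mult[OF M that, unfolded assms(3)] vec_degree_col_mult[OF M(2,1) that, unfolded assms(4)] that
    by (simp_all add: vec_degree_unit_vec)
  have "\<phi> \<in> alg_aut L"
  proof (rule alg_autI[OF \<phi>(1) \<psi>(1)])
    fix i assume i: "i < n"
    have "homogeneous (\<phi> (\<psi> (y i))) (mat_degree M (vec_degree (col M' i)))"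
      by (rule monomial_end_homogeneous[OF M(1) \<phi>(1)]) (simp_all add: i \<phi>(2) \<psi>(2) homogeneous_y_monomial)
    then show "homogeneous (\<phi> (\<psi> (y i))) (Poly_Mapping.single i 1)" by (simp add: inv i)
    have "homogeneous (\<psi> (\<phi> (y i))) (mat_degree M' (vec_degree (col M i)))"
      by (rule monomial_end_homogeneous[OF M(2) \<psi>(1)]) (simp_all add: i \<phi>(2) \<psi>(2) homogeneous_y_monomial)
    then show "homogeneous (\<psi> (\<phi> (y i))) (Poly_Mapping.single i 1)" by (simp add: inv i)
  qed
  then show thesis using \<phi> by (intro that[of \<phi>]) (simp add: is_tau_mat_def)
qed

text \<open>Degrees are functions on all natural numbers. This ensures that cutting them to the
  first \<open>n\<close> coordinates, as columns of a matrix, loses nothing.\<close>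

lemma homogeneous_support:
  assumes "homogeneous u d" "n \<le> k"
  shows "Poly_Mapping.lookup d k = 0"
proof -
  obtain xs where xs: "set xs \<subseteq> gens n" "word_degree (Word xs) = d"
    using assms(1) by (rule homogeneous_imp_word)
  have "Poly_Mapping.lookup (word_degree (Word xs)) k = 0"
    using xs(1)
  proof (induction xs)
    case (Cons a xs)
    then show ?case using assms(2) by (cases a) (auto simp: lookup_add lookup_single when_def)
  qed simp
  with xs show ?thesis by simp
qed

lemma alg_aut_matrix:
  assumes \<phi>: "\<phi> \<in> alg_aut L"
  obtains M where "M \<in> carrier_mat n n" "\<And>i. i < n \<Longrightarrow> homogeneous (\<phi> (y i)) (vec_degree (col M i))"
proof -
  have "\<exists>d. homogeneous (\<phi> (y i)) d" if "i < n" for i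
  proof -
    have "\<phi> (y i) \<in> carrier L" "\<phi> (cl (free_gen (Gen_inv i))) \<in> carrier L" "\<phi> \<in> alg_end"
      using \<phi> that by (auto simp: alg_aut_iff intro: alg_endD(1))
    then show ?thesis
      using alg_end_inverse_letter(1)[of \<phi> i] that invertible_imp_homogeneous by metis
  qed
  then obtain d where d: "\<And>i. i < n \<Longrightarrow> homogeneous (\<phi> (y i)) (d i)" by metis
  define M where "M = mat n n (\<lambda>(k, i). Poly_Mapping.lookup (d i) k)"
  have "vec_degree (col M i) = d i" if "i < n" for i
    using that homogeneous_support[OF d[OF that]]
    by (intro poly_mapping_eqI) (auto simp: lookup_vec_degree M_def)
  with d show thesis by (intro that[of M]) (auto simp: M_def)
qed

lemma alg_aut_matrix_preserves:
  assumes \<phi>: "\<phi> \<in> alg_end" and M: "M \<in> carrier_mat n n"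
    and hom: "\<And>i. i < n \<Longrightarrow> homogeneous (\<phi> (y i)) (vec_degree (col M i))"
  shows "preserves_form M"
  unfolding preserves_form_def
proof (intro conjI M allI impI)
  fix i j assume ij: "i < n" "j < n"
  have "y i \<otimes>\<^bsub>L\<^esub> y j = (q powi (H $$ (i, j))) \<odot>\<^bsub>L\<^esub> (y j \<otimes>\<^bsub>L\<^esub> y i)"
    using homogeneous_swap_iff[OF homogeneous_y homogeneous_y] ij skew_form_single[OF ij, of 1 1] by auto
  then have "\<phi> (y i \<otimes>\<^bsub>L\<^esub> y j) = \<phi> ((q powi (H $$ (i, j))) \<odot>\<^bsub>L\<^esub> (y j \<otimes>\<^bsub>L\<^esub> y i))" by simp
  then have "\<phi> (y i) \<otimes>\<^bsub>L\<^esub> \<phi> (y j) = (q powi (H $$ (i, j))) \<odot>\<^bsub>L\<^esub> (\<phi> (y j) \<otimes>\<^bsub>L\<^esub> \<phi> (y i))"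
    using ij by (simp add: alg_endD[OF \<phi>])
  then show "q powi ((transpose_mat M * H * M) $$ (i, j)) = q powi (H $$ (i, j))"
    using homogeneous_swap_iff[OF hom hom] ij skew_form_cols[OF M ij] by auto
qed

text \<open>The degree of \<open>\<phi> (\<psi> (y i))\<close> is column \<open>i\<close> of
  \<open>M * M'\<close>; the element being \<open>y i\<close>, uniqueness of degrees makes it the
  unit vector.\<close>

lemma inverse_matrices:
  assumes \<phi>: "\<phi> \<in> alg_end" and M: "M \<in> carrier_mat n n" "M' \<in> carrier_mat n n"
    and hom: "\<And>i. i < n \<Longrightarrow> homogeneous (\<phi> (y i)) (vec_degree (col M i))"
    and hom': "\<And>i. i < n \<Longrightarrow> homogeneous (\<psi> (y i)) (vec_degree (col M' i))"
    and inv: "\<And>i. i < n \<Longrightarrow> \<phi> (\<psi> (y i)) = y i"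
  shows "M * M' = 1\<^sub>m n"
proof (rule vec_degree_col_eqI)
  fix i assume i: "i < n"
  have "homogeneous (\<phi> (\<psi> (y i))) (mat_degree M (vec_degree (col M' i)))"
    by (rule monomial_end_homogeneous[OF M(1) \<phi> hom hom'[OF i]])
  then have "mat_degree M (vec_degree (col M' i)) = Poly_Mapping.single i 1"
    using inv[OF i] homogeneous_y[OF i] homogeneous_unique by simp
  then show "vec_degree (col (M * M') i) = vec_degree (col (1\<^sub>m n) i)"
    unfolding vec_degree_col_mult[OF M i] using i by (simp add: vec_degree_unit_vec)
qed (use M in auto)

text \<open>Take \<open>\<sigma>\<close> to be \<open>\<phi>\<close> after the inverse of
  \<open>\<tau>\<close>: both have degree matrix \<open>M\<close>, so \<open>\<sigma>\<close>
  preserves the degree of each generator and is a scaling. The map \<open>\<tau>\<close> is a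
  premise because its existence is the business of \<open>tau_mat_exists\<close>.\<close>

lemma alg_aut_decompose:
  assumes \<phi>: "\<phi> \<in> alg_aut L"
  obtains M M' where "preserves_form M" "preserves_form M'" "M * M' = 1\<^sub>m n" "M' * M = 1\<^sub>m n"
    "\<And>\<tau>. is_tau_mat q H M \<tau> \<Longrightarrow>
      \<exists>c\<in>torus n. \<exists>\<sigma>. is_tau_scal q H c \<sigma> \<and> \<phi> = compose (carrier L) \<sigma> \<tau>"
proof -
  obtain \<psi> where \<psi>: "\<psi> \<in> alg_aut L" "\<And>x. x \<in> carrier L \<Longrightarrow> \<phi> (\<psi> x) = x" "\<And>x. x \<in> carrier L \<Longrightarrow> \<psi> (\<phi> x) = x"
    using alg_aut_inverse[OF \<phi>] by blast
  have ends: "\<phi> \<in> alg_end" "\<psi> \<in> alg_end" using \<phi> \<psi> by (auto simp: alg_aut_iff)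
  obtain M where M: "M \<in> carrier_mat n n" "\<And>i. i < n \<Longrightarrow> homogeneous (\<phi> (y i)) (vec_degree (col M i))"
    using alg_aut_matrix[OF \<phi>] by blast
  obtain M' where M': "M' \<in> carrier_mat n n" "\<And>i. i < n \<Longrightarrow> homogeneous (\<psi> (y i)) (vec_degree (col M' i))"
    using alg_aut_matrix[OF \<psi>(1)] by blast
  have inv: "M * M' = 1\<^sub>m n" "M' * M = 1\<^sub>m n"
    using inverse_matrices[of \<phi> M M' \<psi>] inverse_matrices[of \<psi> M' M \<phi>] M M' ends \<psi> by simp_all
  show thesis
  proof (rule that[OF _ _ inv])
    show "preserves_form M" "preserves_form M'"
      using alg_aut_matrix_preserves M M' ends by blast+
    fix \<tau> assume \<tau>: "is_tau_mat q H M \<tau>"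
    then have \<tau>_end: "\<tau> \<in> alg_end" and "\<tau> \<in> alg_aut L" by (auto simp: is_tau_mat_def alg_aut_iff)
    then obtain \<rho> where \<rho>: "\<rho> \<in> alg_aut L" "\<And>x. x \<in> carrier L \<Longrightarrow> \<tau> (\<rho> x) = x" "\<And>x. x \<in> carrier L \<Longrightarrow> \<rho> (\<tau> x) = x"
      using alg_aut_inverse by blast
    then have \<rho>_end: "\<rho> \<in> alg_end" by (simp add: alg_aut_iff)
    obtain R where R: "R \<in> carrier_mat n n" "\<And>i. i < n \<Longrightarrow> homogeneous (\<rho> (y i)) (vec_degree (col R i))"
      using alg_aut_matrix[OF \<rho>(1)] by blast
    have \<tau>_hom: "homogeneous (\<tau> (y i)) (vec_degree (col M i))" if "i < n" for i
      using \<tau> that homogeneous_y_monomial by (simp add: is_tau_mat_def)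
    \<comment> \<open>\<open>R\<close> is the degree matrix of the inverse of \<open>\<tau>\<close>,
      so this product also governs the degrees of \<open>\<phi>\<close> after
      \<open>\<rho>\<close>.\<close>
    have MR: "M * R = 1\<^sub>m n"
      by (rule inverse_matrices[OF \<tau>_end M(1) R(1) \<tau>_hom R(2)]) (simp_all add: \<rho>)
    define \<sigma> where "\<sigma> = compose (carrier L) \<phi> \<rho>"
    have \<sigma>: "\<sigma> \<in> alg_aut L" unfolding \<sigma>_def by (rule alg_aut_compose[OF \<phi> \<rho>(1)])
    have "\<exists>c. c \<noteq> 0 \<and> \<sigma> (y i) = c \<odot>\<^bsub>L\<^esub> y i" if i: "i < n" for i
    proof -
      have "homogeneous (\<phi> (\<rho> (y i))) (mat_degree M (vec_degree (col R i)))"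
        by (rule monomial_end_homogeneous[OF M(1) ends(1) M(2) R(2)[OF i]])
      moreover have "mat_degree M (vec_degree (col R i)) = Poly_Mapping.single i 1"
        using vec_degree_col_mult[OF M(1) R(1) i, unfolded MR] i by (simp add: vec_degree_unit_vec)
      ultimately have "homogeneous (\<sigma> (y i)) (Poly_Mapping.single i 1)"
        using i by (simp add: \<sigma>_def compose_def)
      then show ?thesis
        using homogeneous_proportional[OF homogeneous_y[OF i]] by metis
    qed
    then obtain c where c: "\<And>i. i < n \<Longrightarrow> c i \<noteq> 0" "\<And>i. i < n \<Longrightarrow> \<sigma> (y i) = c i \<odot>\<^bsub>L\<^esub> y i"
      by metis
    have "is_tau_scal q H (vec n c) \<sigma>" using \<sigma> c by (simp add: is_tau_scal_def)
    moreover have "vec n c \<in> torus n" using c by (simp add: torus_def)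
    moreover have "\<phi> = compose (carrier L) \<sigma> \<tau>"
      using alg_endD(6)[OF ends(1)] alg_endD(1)[OF \<tau>_end] \<rho>(3)
      by (intro extensionalityI[of _ "carrier L"]) (auto simp: \<sigma>_def compose_def)
    ultimately show "\<exists>c\<in>torus n. \<exists>\<sigma>. is_tau_scal q H c \<sigma> \<and> \<phi> = compose (carrier L) \<sigma> \<tau>"
      by blast
  qed
qed

end

section \<open>Matrices in canonical form\<close>

lemma S_mat_index:
  "dim_row S_mat = 2" "dim_col S_mat = 2"
  "S_mat $$ (0, 0) = 0" "S_mat $$ (0, Suc 0) = 1" "S_mat $$ (Suc 0, 0) = - 1" "S_mat $$ (Suc 0, Suc 0) = 0"
  by (simp_all add: S_mat_def mat_of_rows_list_def)

lemma Lambda_Cons: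
  "Lambda (m # ms) = four_block_mat (int m \<cdot>\<^sub>m S_mat) (0\<^sub>m 2 (dim_col (Lambda ms))) (0\<^sub>m (dim_row (Lambda ms)) 2) (Lambda ms)"
  by (simp add: Lambda_def Let_def S_mat_index)

lemma Lambda_carrier: "Lambda ms \<in> carrier_mat (2 * length ms) (2 * length ms)"
proof (induction ms)
  case Nil
  then show ?case by (simp add: Lambda_def)
next
  case (Cons m ms)
  then show ?case by (intro carrier_matI) (simp_all add: Lambda_Cons S_mat_index)
qed

lemma Lambda_index:
  assumes "i < 2 * length ms" "j < 2 * length ms"
  shows "Lambda ms $$ (i, j) =
    (if i div 2 = j div 2 \<and> i \<noteq> j then (if i < j then int (ms ! (i div 2)) else - int (ms ! (i div 2))) else 0)"
  using assms
proof (induction ms arbitrary: i j)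
  case (Cons m ms)
  have dims [simp]: "dim_row (Lambda ms) = 2 * length ms" "dim_col (Lambda ms) = 2 * length ms"
    using Lambda_carrier[of ms] by auto
  \<comment> \<open>An index lies in the leading 2 by 2 block or is an index of the tail shifted by
    two.\<close>
  have small: "k = 0 \<or> k = Suc 0 \<or> (\<exists>k'. k = Suc (Suc k'))" for k :: nat
    by (cases k) (auto intro: not0_implies_Suc)
  show ?case
    using small[of i] small[of j] Cons.prems
    by (elim disjE exE) (simp_all add: Lambda_Cons S_mat_index Cons.IH)
qed simp

lemma canonical_form_carrier:
  "2 * length ms \<le> n \<Longrightarrow> canonical_form n ms \<in> carrier_mat n n"
  using Lambda_carrier[of ms] by (intro carrier_matI) (auto simp: canonical_form_def Let_def)

lemma canonical_form_index:
  assumes "2 * length ms \<le> n" "i < n" "j < n"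
  shows "canonical_form n ms $$ (i, j) =
    (if i < 2 * length ms \<and> i div 2 = j div 2 \<and> i \<noteq> j
     then (if i < j then int (ms ! (i div 2)) else - int (ms ! (i div 2))) else 0)"
proof -
  have dims: "dim_row (Lambda ms) = 2 * length ms" "dim_col (Lambda ms) = 2 * length ms"
    using Lambda_carrier[of ms] by auto
  \<comment> \<open>The number \<open>2 * length ms\<close> is even, so no 2 by 2 block straddles
    it; testing \<open>i\<close> alone is therefore enough.\<close>
  have "j < 2 * length ms" if "i < 2 * length ms" "i div 2 = j div 2"
    using that by presburger
  then show ?thesis
    using assms by (simp add: canonical_form_def Let_def dims Lambda_index)
qed

lemma quantum_laurent_canonical_form:
  assumes "2 * length ms \<le> n" "q \<noteq> 0"
  shows "quantum_laurent q (canonical_form n ms) n"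
proof
  show "canonical_form n ms $$ (i, j) = - canonical_form n ms $$ (j, i)" if "i < n" "j < n" for i j
  proof -
    have "i div 2 = j div 2 \<Longrightarrow> i < 2 * length ms \<longleftrightarrow> j < 2 * length ms" by presburger
    then show ?thesis
      using canonical_form_index[OF assms(1) that] canonical_form_index[OF assms(1) that(2,1)]
      by (cases i j rule: linorder_cases) auto
  qed
qed (use assms canonical_form_carrier in auto)

section \<open>Congruence of matrices\<close>

lemma mat_cong_refl: "mat_cong l A A"
  by (simp add: mat_cong_def)

lemma mat_cong_sym: "mat_cong l A B \<Longrightarrow> mat_cong l B A"
  by (auto simp: mat_cong_def cong_sym_eq)

lemma mat_cong_mult:
  assumes "mat_cong l A A'" "mat_cong l B B'" "dim_col A = dim_row B"
  shows "mat_cong l (A * B) (A' * B')"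
  unfolding mat_cong_def
proof (intro conjI allI impI)
  fix i j assume "i < dim_row (A * B)" "j < dim_col (A * B)"
  then show "[(A * B) $$ (i, j) = (A' * B') $$ (i, j)] (mod int l)"
    using assms by (auto simp: mat_cong_def scalar_prod_def intro!: cong_sum cong_mult)
qed (use assms in \<open>auto simp: mat_cong_def\<close>)

lemma mat_cong_transpose: "mat_cong l A B \<Longrightarrow> mat_cong l (transpose_mat A) (transpose_mat B)"
  by (auto simp: mat_cong_def)

text \<open>\<open>H\<close> may be singular and cannot be cancelled, but \<open>M'\<close> is an
  exact inverse: multiply by it on the right for the second claim, then by its transpose on the left
  for the first. The first claim makes the inverse matrix admissible, the second controls the upper
  right block.\<close>

lemma mat_cong_form_inverse:
  assumes H: "H \<in> carrier_mat n n" and M: "M \<in> carrier_mat n n" "M' \<in> carrier_mat n n" "M * M' = 1\<^sub>m n"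
    and cong: "mat_cong l (transpose_mat M * H * M) H"
  shows "mat_cong l (transpose_mat M' * H * M') H" "mat_cong l (transpose_mat M * H) (H * M')"
proof -
  have tM: "transpose_mat M \<in> carrier_mat n n" "transpose_mat M' \<in> carrier_mat n n"
    using M by auto
  have tinv: "transpose_mat M' * transpose_mat M = 1\<^sub>m n"
    using transpose_mult[OF M(1,2)] M(3) by simp
  have "transpose_mat M * H * M * M' = transpose_mat M * H * (M * M')"
    using H M tM by (intro assoc_mult_mat[of _ n n _ n _ n]) auto
  also have "\<dots> = transpose_mat M * H"
    using H M tM by simp
  finally have *: "transpose_mat M * H * M * M' = transpose_mat M * H" .
  with mat_cong_mult[OF cong mat_cong_refl[of l M']] M
  show c: "mat_cong l (transpose_mat M * H) (H * M')" by simp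
  have "mat_cong l (transpose_mat M' * (transpose_mat M * H)) (transpose_mat M' * (H * M'))"
    by (rule mat_cong_mult[OF mat_cong_refl c]) (use M in auto)
  moreover have "transpose_mat M' * (transpose_mat M * H) = H"
    using assoc_mult_mat[OF tM(2,1) H] tinv H by simp
  moreover have "transpose_mat M' * (H * M') = transpose_mat M' * H * M'"
    using assoc_mult_mat[OF tM(2) H M(2)] by simp
  ultimately show "mat_cong l (transpose_mat M' * H * M') H"
    using mat_cong_sym by simp
qed

text \<open>A determinant of \<open>1\<close> or \<open>-1\<close> is its own inverse, so the
  adjugate times the determinant is an integer inverse.\<close>

lemma GL_int_inverse:
  assumes "M \<in> GL_int n"
  obtains M' where "M' \<in> GL_int n" "M * M' = 1\<^sub>m n" "M' * M = 1\<^sub>m n"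
proof -
  have M: "M \<in> carrier_mat n n" and d: "det M * det M = 1"
    using assms by (auto simp: GL_int_def)
  define M' where "M' = det M \<cdot>\<^sub>m adj_mat M"
  note adj = adj_mat[OF M]
  have M': "M' \<in> carrier_mat n n" using adj by (simp add: M'_def)
  have "det M \<cdot>\<^sub>m (det M \<cdot>\<^sub>m 1\<^sub>m n) = 1\<^sub>m n"
    by (rule eq_matI) (auto simp: d simp flip: mult.assoc)
  then have inv: "M * M' = 1\<^sub>m n" "M' * M = 1\<^sub>m n"
    by (simp_all add: M'_def mult_smult_distrib[OF M adj(1)] mult_smult_assoc_mat[OF adj(1) M] adj(2,3))
  have "det M * det M' = 1"
    using det_mult[OF M M'] inv by simp
  then have "det M' = 1 \<or> det M' = - 1"
    by (auto simp: zmult_eq_1_iff)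
  with M' inv show thesis by (intro that[of M']) (auto simp: GL_int_def)
qed

lemma GL_intI:
  assumes "M \<in> carrier_mat n n" "M' \<in> carrier_mat n n" "M * M' = 1\<^sub>m n"
  shows "M \<in> GL_int n"
proof -
  have "det M * det M' = 1"
    using det_mult[OF assms(1,2)] assms(3) by simp
  then show ?thesis using assms by (auto simp: GL_int_def zmult_eq_1_iff)
qed

text \<open>The lower blocks \<open>C\<close> and \<open>D\<close> meet only zero blocks of the
  canonical form and drop out.\<close>

lemma form_four_block:
  assumes r: "r = 2 * length ms" "r \<le> n"
    and blocks: "A \<in> carrier_mat r r" "B \<in> carrier_mat r (n - r)"
      "C \<in> carrier_mat (n - r) r" "D \<in> carrier_mat (n - r) (n - r)"
    and M: "M = four_block_mat A B C D"
  shows "transpose_mat M * canonical_form n ms * M =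
    four_block_mat (transpose_mat A * Lambda ms * A) (transpose_mat A * Lambda ms * B)
      (transpose_mat B * Lambda ms * A) (transpose_mat B * Lambda ms * B)"
proof -
  have L: "Lambda ms \<in> carrier_mat r r" using Lambda_carrier r by simp
  have t: "transpose_mat A \<in> carrier_mat r r" "transpose_mat B \<in> carrier_mat (n - r) r"
    "transpose_mat C \<in> carrier_mat r (n - r)" "transpose_mat D \<in> carrier_mat (n - r) (n - r)"
    using blocks by auto
  have tL: "transpose_mat A * Lambda ms \<in> carrier_mat r r" "transpose_mat B * Lambda ms \<in> carrier_mat (n - r) r"
    using t L by auto
  have "transpose_mat M * canonical_form n ms =
      four_block_mat (transpose_mat A * Lambda ms) (0\<^sub>m r (n - r)) (transpose_mat B * Lambda ms) (0\<^sub>m (n - r) (n - r))"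
    unfolding M transpose_four_block_mat[OF blocks] canonical_form_def Let_def r(1)[symmetric]
    using L t tL
    by (subst mult_four_block_mat[of _ r r _ "n - r" _ "n - r" _ _ r _ "n - r"]) auto
  then show ?thesis
    unfolding M using blocks tL
    by (simp add: mult_four_block_mat[of _ r r _ "n - r" _ "n - r" _ _ r _ "n - r"])
qed

text \<open>The congruence \<open>M\<^sup>T H \<equiv> H M\<^sup>-\<^sup>1\<close> has the zero blocks of \<open>H\<close> on its right-hand side, which
  makes the upper right block of \<open>M\<close> vanish modulo \<open>l\<close>.\<close>

lemma upper_right_block_cong_zero:
  assumes r: "r = 2 * length ms" "r \<le> n" and coprime: "\<forall>m\<in>set ms. coprime m l"
    and M: "M \<in> carrier_mat n n" "M' \<in> carrier_mat n n"
    and cong: "mat_cong l (transpose_mat M * canonical_form n ms) (canonical_form n ms * M')"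
    and ij: "i < r" "r \<le> j" "j < n"
  shows "[M $$ (i, j) = 0] (mod int l)"
proof -
  let ?H = "canonical_form n ms"
  have H: "?H \<in> carrier_mat n n" using canonical_form_carrier r by simp
  \<comment> \<open>\<open>k\<close> is the other index in the 2 by 2 block of \<open>i\<close>.
    Column \<open>k\<close> of the canonical form can be nonzero only in row \<open>i\<close>, so
    entry \<open>(j, k)\<close> of the product isolates \<open>M $$ (i, j)\<close>.\<close>
  define k where "k = (if even i then i + 1 else i - 1)"
  have k: "k < r" "k div 2 = i div 2" "k \<noteq> i"
    using ij(1) by (auto simp: k_def r(1) elim!: evenE oddE)
  have rn: "2 * length ms \<le> n" "i < n" "k < n" "j < n" "\<not> j < 2 * length ms"
    using r ij k(1) by auto
  have parity: "a = b" if "a div 2 = b div 2" "even a = even b" for a b :: nat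
    using that by (metis div_mult_mod_eq mod2_eq_if)
  have partner: "a = i" if "a div 2 = k div 2" "a \<noteq> k" for a
    using parity[of a i] parity[of k i] parity[of a k] k(2,3) that by argo
  have "(transpose_mat M * ?H) $$ (j, k) = (\<Sum>a<n. M $$ (a, j) * ?H $$ (a, k))"
    using M H rn by (simp add: scalar_prod_def atLeast0LessThan)
  also have "\<dots> = (\<Sum>a<n. if a = i then M $$ (i, j) * ?H $$ (i, k) else 0)"
  proof (intro sum.cong refl)
    fix a assume "a \<in> {..<n}"
    then have a: "a < n" by simp
    show "M $$ (a, j) * ?H $$ (a, k) = (if a = i then M $$ (i, j) * ?H $$ (i, k) else 0)"
    proof (cases "a = i")
      case False
      have "?H $$ (a, k) = 0"
        unfolding canonical_form_index[OF rn(1) a rn(3)] by (rule if_not_P) (use partner False in blast)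
      with False show ?thesis by simp
    qed simp
  qed
  also have "\<dots> = M $$ (i, j) * ?H $$ (i, k)"
    using ij r by simp
  finally have left: "(transpose_mat M * ?H) $$ (j, k) = M $$ (i, j) * ?H $$ (i, k)" .
  have "(?H * M') $$ (j, k) = (\<Sum>a<n. ?H $$ (j, a) * M' $$ (a, k))"
    using M H rn by (simp add: scalar_prod_def atLeast0LessThan)
  also have "\<dots> = 0"
    using rn by (intro sum.neutral ballI) (simp add: canonical_form_index)
  finally have right: "(?H * M') $$ (j, k) = 0" .
  have "[M $$ (i, j) * ?H $$ (i, k) = 0] (mod int l)"
  proof -
    have "j < dim_row (transpose_mat M * ?H)" "k < dim_col (transpose_mat M * ?H)"
      using M H rn by auto
    then have "[(transpose_mat M * ?H) $$ (j, k) = (?H * M') $$ (j, k)] (mod int l)"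
      using cong unfolding mat_cong_def by blast
    then show ?thesis unfolding left right .
  qed
  \<comment> \<open>Up to sign this entry is the \<open>m\<close> of the block, which can be
    cancelled modulo \<open>l\<close>.\<close>
  moreover have "coprime (?H $$ (i, k)) (int l)"
  proof -
    have "ms ! (i div 2) \<in> set ms" using ij(1) r(1) by (intro nth_mem) simp
    moreover have cond: "i < 2 * length ms \<and> i div 2 = k div 2 \<and> i \<noteq> k"
      using k(2,3) ij(1) r(1) by metis
    moreover note bspec[OF coprime]
    ultimately have "coprime (int (ms ! (i div 2))) (int l)" by simp
    then show ?thesis
      unfolding canonical_form_index[OF rn(1-3)] if_P[OF cond] by simp
  qed
  ultimately show ?thesis
    by (metis cong_0_iff coprime_commute coprime_dvd_mult_left_iff)
qed

text \<open>If \<open>B\<close> vanishes modulo \<open>l\<close>, every block of the transformed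
  form but the upper left one vanishes too. Conversely, that block is the condition on
  \<open>A\<close>, and coprimality yields the condition on \<open>B\<close> through
  \<open>upper_right_block_cong_zero\<close>.\<close>

lemma Q_group_iff:
  assumes n: "2 * length ms \<le> n" and coprime: "\<forall>m\<in>set ms. coprime m l"
  shows "M \<in> Q_group n l ms \<longleftrightarrow>
    M \<in> GL_int n \<and> mat_cong l (transpose_mat M * canonical_form n ms * M) (canonical_form n ms)"
proof
  let ?r = "2 * length ms"
  have L: "Lambda ms \<in> carrier_mat ?r ?r" by (rule Lambda_carrier)
  {
    assume "M \<in> Q_group n l ms"
    then obtain A B C D where M: "M \<in> GL_int n" "M = four_block_mat A B C D"
      and blocks: "A \<in> carrier_mat ?r ?r" "B \<in> carrier_mat ?r (n - ?r)"
        "C \<in> carrier_mat (n - ?r) ?r" "D \<in> carrier_mat (n - ?r) (n - ?r)"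
      and cong: "mat_cong l (transpose_mat A * Lambda ms * A) (Lambda ms)" "mat_cong l B (0\<^sub>m ?r (n - ?r))"
      by (auto simp: Q_group_def Let_def)
    have "mat_cong l (transpose_mat A * Lambda ms * B) (transpose_mat A * Lambda ms * 0\<^sub>m ?r (n - ?r))"
      using blocks L cong by (intro mat_cong_mult mat_cong_refl) auto
    moreover have "transpose_mat A * Lambda ms * 0\<^sub>m ?r (n - ?r) = 0\<^sub>m ?r (n - ?r)"
      using blocks L by (intro right_mult_zero_mat) auto
    ultimately have c2: "mat_cong l (transpose_mat A * Lambda ms * B) (0\<^sub>m ?r (n - ?r))" by simp
    have tB: "mat_cong l (transpose_mat B) (0\<^sub>m (n - ?r) ?r)"
      using mat_cong_transpose[OF cong(2)] by simp
    \<comment> \<open>\<open>X\<close> will be \<open>A\<close> and then \<open>B\<close>, which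
      settles both lower blocks.\<close>
    have c34: "mat_cong l (transpose_mat B * Lambda ms * X) (0\<^sub>m (n - ?r) k)" if "X \<in> carrier_mat ?r k" for X k
    proof -
      have "mat_cong l (transpose_mat B * Lambda ms * X) (0\<^sub>m (n - ?r) ?r * Lambda ms * X)"
        using blocks L tB that by (intro mat_cong_mult mat_cong_refl) auto
      moreover have "0\<^sub>m (n - ?r) ?r * Lambda ms * X = 0\<^sub>m (n - ?r) k"
        using that L by simp
      ultimately show ?thesis by simp
    qed
    have "mat_cong l (four_block_mat (transpose_mat A * Lambda ms * A) (transpose_mat A * Lambda ms * B)
      (transpose_mat B * Lambda ms * A) (transpose_mat B * Lambda ms * B)) (canonical_form n ms)"
      using cong(1) c2 c34[OF blocks(1)] c34[OF blocks(2)] blocks L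
      unfolding canonical_form_def Let_def mat_cong_def by auto
    then show "M \<in> GL_int n \<and> mat_cong l (transpose_mat M * canonical_form n ms * M) (canonical_form n ms)"
      using M form_four_block[OF refl n blocks M(2)] by simp
  }
  assume M: "M \<in> GL_int n \<and> mat_cong l (transpose_mat M * canonical_form n ms * M) (canonical_form n ms)"
  then have Mc: "M \<in> carrier_mat n n" by (simp add: GL_int_def)
  obtain M' where M': "M' \<in> GL_int n" "M * M' = 1\<^sub>m n"
    using M GL_int_inverse by metis
  then have M'c: "M' \<in> carrier_mat n n" by (simp add: GL_int_def)
  obtain A B C D where split: "split_block M ?r ?r = (A, B, C, D)"
    by (metis prod_cases4)
  have "dim_row M = ?r + (n - ?r)" "dim_col M = ?r + (n - ?r)" using Mc n by auto
  note blocks = split_block[OF split this]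
  have "mat_cong l B (0\<^sub>m ?r (n - ?r))"
    unfolding mat_cong_def
  proof (intro conjI allI impI)
    fix i j assume "i < dim_row B" "j < dim_col B"
    then have ij: "i < ?r" "j < n - ?r" using blocks(2) by auto
    have "[M $$ (i, ?r + j) = 0] (mod int l)"
      using ij by (intro upper_right_block_cong_zero[OF refl n coprime Mc M'c]
          mat_cong_form_inverse(2)[OF canonical_form_carrier[OF n] Mc M'c M'(2) conjunct2[OF M]]) auto
    then show "[B $$ (i, j) = 0\<^sub>m ?r (n - ?r) $$ (i, j)] (mod int l)"
      using ij blocks by simp
  qed (use blocks in auto)
  moreover have "mat_cong l (transpose_mat A * Lambda ms * A) (Lambda ms)"
    unfolding mat_cong_def
  proof (intro conjI allI impI)
    fix i j assume "i < dim_row (transpose_mat A * Lambda ms * A)" "j < dim_col (transpose_mat A * Lambda ms * A)"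
    then have ij: "i < ?r" "j < ?r" using blocks(1) by auto
    have "[(transpose_mat M * canonical_form n ms * M) $$ (i, j) = canonical_form n ms $$ (i, j)] (mod int l)"
      using M Mc ij n canonical_form_carrier[OF n] by (auto simp: mat_cong_def)
    moreover have "(transpose_mat M * canonical_form n ms * M) $$ (i, j) = (transpose_mat A * Lambda ms * A) $$ (i, j)"
      unfolding form_four_block[OF refl n blocks] using blocks L ij by simp
    moreover have "canonical_form n ms $$ (i, j) = Lambda ms $$ (i, j)"
      using ij L n by (simp add: canonical_form_def Let_def)
    ultimately show "[(transpose_mat A * Lambda ms * A) $$ (i, j) = Lambda ms $$ (i, j)] (mod int l)" by simp
  qed (use blocks L in auto)
  ultimately show "M \<in> Q_group n l ms"
    using M blocks by (auto simp: Q_group_def Let_def)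
qed

text \<open>Exponents can be reduced modulo \<open>l\<close>, and by primitivity \<open>0\<close> is
  the only remainder at which the power is \<open>1\<close>.\<close>

lemma primitive_root_powi_eq_iff:
  assumes "2 \<le> l" "primitive_root_of_one l q"
  shows "q powi a = q powi b \<longleftrightarrow> [a = b] (mod int l)"
proof -
  have ql: "q ^ l = 1" and prim: "\<And>k. 0 < k \<Longrightarrow> k < l \<Longrightarrow> q ^ k \<noteq> 1"
    using assms by (auto simp: primitive_root_of_one_def)
  have q: "q \<noteq> 0"
    using ql assms(1) by (auto simp: power_0_left split: if_splits)
  have reduce: "q powi k = q ^ nat (k mod int l)" for k
  proof -
    have "q powi k = q powi (int l * (k div int l) + k mod int l)" by simp
    also have "\<dots> = (q powi int l) powi (k div int l) * q powi (k mod int l)"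
      using q by (simp only: power_int_add power_int_mult simp_thms)
    also have "\<dots> = q powi (k mod int l)" using ql by simp
    also have "\<dots> = q ^ nat (k mod int l)" using assms(1) by (simp add: power_int_def)
    finally show ?thesis .
  qed
  have "q powi a = q powi b \<longleftrightarrow> q powi (a - b) = 1"
    using q by (simp add: power_int_diff)
  also have "\<dots> \<longleftrightarrow> (a - b) mod int l = 0"
  proof -
    define m where "m = (a - b) mod int l"
    have m: "0 \<le> m" "m < int l" using assms(1) by (simp_all add: m_def)
    have "q ^ nat m = 1 \<longleftrightarrow> m = 0"
    proof (cases "m = 0")
      case False
      with m have "0 < nat m" "nat m < l" by linarith+
      with prim False show ?thesis by blast
    qed simp
    then show ?thesis unfolding reduce m_def .
  qed
  also have "\<dots> \<longleftrightarrow> [a = b] (mod int l)"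
    by (simp add: cong_iff_dvd_diff dvd_eq_mod_eq_0)
  finally show ?thesis .
qed

section \<open>Assembly of the automorphism group\<close>

context quantum_laurent
begin

text \<open>Here \<open>H\<close> is any skew-symmetric matrix and \<open>G\<close> is described by
  a single congruence. The canonical shape and coprimality enter afterwards, when
  \<open>Q_group\<close> is identified with such a \<open>G\<close>.\<close>

lemma alg_aut_eq_scal_mat:
  assumes l: "2 \<le> l" "primitive_root_of_one l q"
    and Q: "\<And>M. M \<in> G \<longleftrightarrow> M \<in> GL_int n \<and> mat_cong l (transpose_mat M * H * M) H"
  shows "(\<forall>c\<in>torus n. \<exists>!\<tau>. is_tau_scal q H c \<tau>) \<and>
         (\<forall>M\<in>G. \<exists>!\<tau>. is_tau_mat q H M \<tau>) \<and>
         alg_aut L = {compose (carrier L) (tau_scal q H c) (tau_mat q H M) | c M. c \<in> torus n \<and> M \<in> G}"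
proof -
  have preserves_iff: "preserves_form M \<longleftrightarrow> M \<in> carrier_mat n n \<and> mat_cong l (transpose_mat M * H * M) H" for M
  proof -
    have "dim_row (transpose_mat M * H * M) = n" "dim_col (transpose_mat M * H * M) = n" "dim_col H = n"
      if "M \<in> carrier_mat n n"
      using that H_carrier by simp_all
    then show ?thesis
      by (simp add: preserves_form_def mat_cong_def primitive_root_powi_eq_iff[OF l] cong: conj_cong)
  qed
  have GL_carrier: "M \<in> carrier_mat n n" if "M \<in> GL_int n" for M
    using that by (simp add: GL_int_def)
  have Q_iff: "M \<in> G \<longleftrightarrow> M \<in> GL_int n \<and> preserves_form M" for M
    unfolding preserves_iff Q using GL_carrier by blast
  have scal: "\<exists>!\<tau>. is_tau_scal q H c \<tau>" if "c \<in> torus n" for c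
    by (rule tau_scal_unique[OF that])
  have mat: "\<exists>!\<tau>. is_tau_mat q H M \<tau>" if "M \<in> G" for M
  proof -
    from that have M: "M \<in> GL_int n" "preserves_form M" by (simp_all only: Q_iff)
    obtain M' where M': "M' \<in> GL_int n" "M * M' = 1\<^sub>m n" "M' * M = 1\<^sub>m n"
      using GL_int_inverse[OF M(1)] by blast
    have "preserves_form M'"
      using mat_cong_form_inverse(1)[OF H_carrier GL_carrier[OF M(1)] GL_carrier[OF M'(1)] M'(2)]
        M(2) GL_carrier[OF M'(1)] unfolding preserves_iff by blast
    then show ?thesis
      using tau_mat_exists[OF M(2) _ M'(2,3)] tau_mat_unique by metis
  qed
  have tau_scal: "is_tau_scal q H c (tau_scal q H c)" if "c \<in> torus n" for c
    unfolding tau_scal_def by (rule theI'[OF scal[OF that]])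
  have tau_mat: "is_tau_mat q H M (tau_mat q H M)" if "M \<in> G" for M
    unfolding tau_mat_def by (rule theI'[OF mat[OF that]])
  have "\<exists>c M. \<phi> = compose (carrier L) (tau_scal q H c) (tau_mat q H M) \<and> c \<in> torus n \<and> M \<in> G"
    if \<phi>: "\<phi> \<in> alg_aut L" for \<phi>
  proof -
    obtain M M' where M: "preserves_form M" "preserves_form M'" "M * M' = 1\<^sub>m n" "M' * M = 1\<^sub>m n"
      and dec: "\<And>\<tau>. is_tau_mat q H M \<tau> \<Longrightarrow>
        \<exists>c\<in>torus n. \<exists>\<sigma>. is_tau_scal q H c \<sigma> \<and> \<phi> = compose (carrier L) \<sigma> \<tau>"
      using alg_aut_decompose[OF \<phi>] by metis
    have MQ: "M \<in> G"
      using M GL_intI[of M n M'] unfolding Q_iff preserves_iff by blast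
    obtain c \<sigma> where c: "c \<in> torus n" "is_tau_scal q H c \<sigma>" "\<phi> = compose (carrier L) \<sigma> (tau_mat q H M)"
      using dec[OF tau_mat[OF MQ]] by blast
    then have "\<sigma> = tau_scal q H c" using scal tau_scal by blast
    with c MQ show ?thesis by blast
  qed
  moreover have "compose (carrier L) (tau_scal q H c) (tau_mat q H M) \<in> alg_aut L"
    if "c \<in> torus n" "M \<in> G" for c M
    using tau_scal[OF that(1)] tau_mat[OF that(2)] alg_aut_compose
    by (simp add: is_tau_scal_def is_tau_mat_def)
  ultimately show ?thesis
    using scal mat by blast
qed

end

text \<open>The two uniqueness clauses make the \<open>THE\<close> in \<open>tau_scal\<close> and
  \<open>tau_mat\<close> meaningful for the parameters that occur in the set.\<close>

theorem theorem3p2: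
  fixes n l :: nat and ms :: "nat list" and q :: complex and H :: "int mat"
  assumes "\<forall>m\<in>set ms. 0 < m" and "sorted ms"
    and "2 * length ms \<le> n"
    and "H = canonical_form n ms"
    and "2 \<le> l" and "primitive_root_of_one l q"
    and "\<forall>m\<in>set ms. coprime m l"
  shows "(\<forall>c\<in>torus n. \<exists>!\<tau>. is_tau_scal q H c \<tau>) \<and>
         (\<forall>M\<in>Q_group n l ms. \<exists>!\<tau>. is_tau_mat q H M \<tau>) \<and>
         alg_aut (laurent q H) =
           {compose (carrier (laurent q H)) (tau_scal q H c) (tau_mat q H M) | c M.
              c \<in> torus n \<and> M \<in> Q_group n l ms}"
proof -
  have "q \<noteq> 0"
    using assms(5,6) by (auto simp: primitive_root_of_one_def power_0_left split: if_splits)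
  then have "quantum_laurent q H n"
    unfolding assms(4) by (rule quantum_laurent_canonical_form[OF assms(3)])
  from quantum_laurent.alg_aut_eq_scal_mat[OF this assms(5,6)] show ?thesis
    using Q_group_iff[OF assms(3,7), folded assms(4)] .
qed

end
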